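(* Let $n\ge1$, $\alpha>0$, $p>1$ and let $q$ be the conjugate exponent of $p$. If $f\in F_\alpha^p$ and $g\in F_\alpha^q$, then the following are equivalent: (a) $T_fT_{\overline g}$ is bounded on $F_\alpha^p$. (b) $f$ and $g$ satisfy $$\sup_{z\in\mathbb{C}^n}\left(\widetilde{|f|^p}^{\left(\frac{\alpha p}{2}\right)}(z)\right)^{\frac1p}\left(\widetilde{|g|^q}^{\left(\frac{\alpha q}{2}\right)}(z)\right)^{\frac1q}<\infty.$$ Furthermore, if either of these is true then $fg$ is identically constant, and if moreover both $f$ and $g$ never vanish on $\mathbb{C}^n$, then $f=e^{P}$ for a linear polynomial $P$ on $\mathbb{C}^n$ and $g=ce^{-P}$ for some $c\in\mathbb{C}$ (in which case $T_fT_{\overline{f^{-1}}}$ is invertible on $F_\alpha^p$).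
   Context: $dv$ is Lebesgue measure on $\mathbb{C}^n$ and $z\cdot u=\sum_jz_j\overline{u_j}$. $F_\alpha^p$ is the Fock space of all entire functions $f$ on $\mathbb{C}^n$ with $f(\cdot)e^{-\frac\alpha2|\cdot|^2}\in L^p(\mathbb{C}^n,(p\alpha/2\pi)^n\,dv)$, with the corresponding norm. The Fock projection is $P_\alpha h(z)=\left(\frac\alpha\pi\right)^n\int_{\mathbb{C}^n}e^{\alpha z\cdot u}h(u)e^{-\alpha|u|^2}\,dv(u)$. For $\beta>0$ and a function $h$ on $\mathbb{C}^n$, $$\widetilde h^{(\beta)}(z)=\left(\frac\beta\pi\right)^n\int_{\mathbb{C}^n}e^{-\beta|z-u|^2}h(u)\,dv(u).$$ In (b) the convention $0\cdot\infty=0$ is used (relevant only if one of $f,g$ is identically $0$). The Toeplitz operator with symbol $\phi$ is $T_\phi=P_\alpha M_\phi$, where $M_\phi$ is multiplication by $\phi$. For entire $f,g$ as in the claim, $T_fT_{\overline g}$ is densely defined on the linear span of the normalized reproducing kernels $k_z(u)=e^{\alpha u\cdot z-\frac\alpha2|z|^2}$, $z\in\mathbb{C}^n$ (which is dense in $F_\alpha^p$), by $T_fT_{\overline g}h=f\,P_\alpha(\overline g h)$. It is bounded on $F_\alpha^p$ if it maps this span into $F_\alpha^p$ and extends to a bounded operator on $F_\alpha^p$; invertibility refers to this bounded extension having a bounded inverse. A linear polynomial is a polynomial of degree at most one (a constant term is allowed). *)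

theory Defs
  imports "HOL-Analysis.Analysis"
begin

text \<open>
  The space of \<open>n\<close>-tuples of complex numbers is \<^typ>\<open>complex ^ 'n\<close>, with \<open>n = CARD('n)\<close>.  As a
  Euclidean space it has real dimension \<open>2 n\<close>, and \<^const>\<open>lborel\<close> on it is Lebesgue measure (on
  Borel sets; all integrands considered here are continuous or Borel).
\<close>

definition hdot :: "complex ^ 'n \<Rightarrow> complex ^ 'n \<Rightarrow> complex" where
  "hdot z u = (\<Sum>j\<in>UNIV. z $ j * cnj (u $ j))"

text \<open>Complex differentiability at every point: the Frechet derivative exists and is complex-linear.\<close>

definition entire :: "(complex ^ 'n \<Rightarrow> complex) \<Rightarrow> bool" where
  "entire f \<longleftrightarrow>
     (\<forall>z. \<exists>D. (f has_derivative D) (at z) \<and> (\<forall>c v. D (c *s v) = c * D v))"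

definition fock_space :: "real \<Rightarrow> real \<Rightarrow> (complex ^ 'n \<Rightarrow> complex) set" where
  "fock_space \<alpha> p =
     {f. entire f \<and>
         integrable lborel (\<lambda>z. (norm (f z) * exp (- (\<alpha> / 2) * (norm z)\<^sup>2)) powr p)}"

definition fock_norm :: "real \<Rightarrow> real \<Rightarrow> (complex ^ 'n \<Rightarrow> complex) \<Rightarrow> real" where
  "fock_norm \<alpha> p f =
     ((p * \<alpha> / (2 * pi)) ^ CARD('n) *
      (LINT z|lborel. (norm (f z) * exp (- (\<alpha> / 2) * (norm z)\<^sup>2)) powr p)) powr (1 / p)"

definition fock_proj ::
  "real \<Rightarrow> (complex ^ 'n \<Rightarrow> complex) \<Rightarrow> complex ^ 'n \<Rightarrow> complex" where
  "fock_proj \<alpha> h z =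
     of_real ((\<alpha> / pi) ^ CARD('n)) *
     (LINT u|lborel. exp (of_real \<alpha> * hdot z u) * h u * of_real (exp (- \<alpha> * (norm u)\<^sup>2)))"

definition toeplitz ::
  "real \<Rightarrow> (complex ^ 'n \<Rightarrow> complex) \<Rightarrow> (complex ^ 'n \<Rightarrow> complex) \<Rightarrow> complex ^ 'n \<Rightarrow> complex" where
  "toeplitz \<alpha> \<phi> h = fock_proj \<alpha> (\<lambda>u. \<phi> u * h u)"

definition normalized_kernel :: "real \<Rightarrow> complex ^ 'n \<Rightarrow> complex ^ 'n \<Rightarrow> complex" where
  "normalized_kernel \<alpha> z u = exp (of_real \<alpha> * hdot u z - of_real (\<alpha> / 2 * (norm z)\<^sup>2))"

definition kernel_span :: "real \<Rightarrow> (complex ^ 'n \<Rightarrow> complex) set" where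
  "kernel_span \<alpha> =
     {(\<lambda>u. \<Sum>z\<in>Z. c z * normalized_kernel \<alpha> z u) | Z c. finite Z}"

text \<open>
  The product of the Toeplitz operators with symbols \<open>f\<close> and (the conjugate of) \<open>g\<close>; for entire \<open>f\<close>
  the outer operator acts as multiplication by \<open>f\<close>.
\<close>

definition toeplitz_prod ::
  "real \<Rightarrow> (complex ^ 'n \<Rightarrow> complex) \<Rightarrow> (complex ^ 'n \<Rightarrow> complex) \<Rightarrow>
   (complex ^ 'n \<Rightarrow> complex) \<Rightarrow> complex ^ 'n \<Rightarrow> complex" where
  "toeplitz_prod \<alpha> f g h = (\<lambda>z. f z * toeplitz \<alpha> (\<lambda>u. cnj (g u)) h z)"

text \<open>An operator on the Fock space is a map on all functions; only its values on the space matter.\<close>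

definition bounded_fock_operator ::
  "real \<Rightarrow> real \<Rightarrow> ((complex ^ 'n \<Rightarrow> complex) \<Rightarrow> (complex ^ 'n \<Rightarrow> complex)) \<Rightarrow> bool" where
  "bounded_fock_operator \<alpha> p S \<longleftrightarrow>
     (\<forall>h\<in>fock_space \<alpha> p. S h \<in> fock_space \<alpha> p) \<and>
     (\<forall>h\<in>fock_space \<alpha> p. \<forall>k\<in>fock_space \<alpha> p. \<forall>a b.
        S (\<lambda>z. a * h z + b * k z) = (\<lambda>z. a * S h z + b * S k z)) \<and>
     (\<exists>C. \<forall>h\<in>fock_space \<alpha> p. fock_norm \<alpha> p (S h) \<le> C * fock_norm \<alpha> p h)"

definition toeplitz_prod_extension ::
  "real \<Rightarrow> real \<Rightarrow> (complex ^ 'n \<Rightarrow> complex) \<Rightarrow> (complex ^ 'n \<Rightarrow> complex) \<Rightarrow>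
   ((complex ^ 'n \<Rightarrow> complex) \<Rightarrow> (complex ^ 'n \<Rightarrow> complex)) \<Rightarrow> bool" where
  "toeplitz_prod_extension \<alpha> p f g S \<longleftrightarrow>
     bounded_fock_operator \<alpha> p S \<and> (\<forall>h\<in>kernel_span \<alpha>. S h = toeplitz_prod \<alpha> f g h)"

definition toeplitz_prod_bounded ::
  "real \<Rightarrow> real \<Rightarrow> (complex ^ 'n \<Rightarrow> complex) \<Rightarrow> (complex ^ 'n \<Rightarrow> complex) \<Rightarrow> bool" where
  "toeplitz_prod_bounded \<alpha> p f g \<longleftrightarrow>
     (\<forall>h\<in>kernel_span \<alpha>. toeplitz_prod \<alpha> f g h \<in> fock_space \<alpha> p) \<and>
     (\<exists>S. toeplitz_prod_extension \<alpha> p f g S)"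

definition toeplitz_prod_invertible ::
  "real \<Rightarrow> real \<Rightarrow> (complex ^ 'n \<Rightarrow> complex) \<Rightarrow> (complex ^ 'n \<Rightarrow> complex) \<Rightarrow> bool" where
  "toeplitz_prod_invertible \<alpha> p f g \<longleftrightarrow>
     toeplitz_prod_bounded \<alpha> p f g \<and>
     (\<exists>S R. toeplitz_prod_extension \<alpha> p f g S \<and> bounded_fock_operator \<alpha> p R \<and>
        (\<forall>h\<in>fock_space \<alpha> p. R (S h) = h \<and> S (R h) = h))"

text \<open>
  The transform is stated for nonnegative \<open>h\<close> and may take the value \<open>\<infinity>\<close>: for \<open>f\<close> in the Fock
  space with exponent \<open>p\<close>, the transform of \<open>|f|^p\<close> with parameter \<open>\<alpha> p / 2\<close> need not be finite.
\<close>

definition heat_transform ::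
  "real \<Rightarrow> (complex ^ 'n \<Rightarrow> real) \<Rightarrow> complex ^ 'n \<Rightarrow> ennreal" where
  "heat_transform \<beta> h z =
     ennreal ((\<beta> / pi) ^ CARD('n)) *
     (\<integral>\<^sup>+ u. ennreal (exp (- \<beta> * (norm (z - u))\<^sup>2) * h u) \<partial>lborel)"

text \<open>
  Positive real powers on \<open>[0, \<infinity>]\<close>.  Multiplication on \<^typ>\<open>ennreal\<close> satisfies \<open>0 * \<infinity> = 0\<close>.
\<close>

definition ennreal_pow :: "ennreal \<Rightarrow> real \<Rightarrow> ennreal" where
  "ennreal_pow x r = (if x = \<infinity> then \<infinity> else ennreal (enn2real x powr r))"

definition linear_polynomial :: "(complex ^ 'n \<Rightarrow> complex) \<Rightarrow> bool" where
  "linear_polynomial P \<longleftrightarrow>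
     (\<exists>(a :: complex) (b :: complex ^ 'n). \<forall>z. P z = a + (\<Sum>j\<in>UNIV. b $ j * z $ j))"

end

theory Submission
  imports Defs "HOL-Complex_Analysis.Cauchy_Integral_Formula" "HOL-Probability.Distributions"
begin

text \<open>
  On kernels \<open>T_f T_{g-bar} k_z = cnj (g z) f k_z\<close>, and \<open>\<parallel>f k_z\<parallel>^p\<close> is the heat transform \<open>H_f(z)\<close> of
  \<open>|f|^p\<close>. Hence boundedness of the product makes \<open>H_f(z) |g z|^p\<close> bounded in \<open>z\<close>; so does (b), since
  \<open>|g|^q\<close> lies below its heat transform. Shifting the centre of the Gaussian, \<open>H_f(z)\<close> dominates
  \<open>|f (z + w)|^p\<close> up to a factor depending on \<open>w\<close> only, so by Liouville \<open>f (z + w) g z\<close> does not depend on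
  \<open>z\<close>. Unless \<open>f\<close> or \<open>g\<close> vanishes identically, \<open>f / f 0\<close> is therefore a homomorphism from \<open>\<complex>^n\<close> to the
  multiplicative group, i.e. an exponential, and \<open>g\<close> is a multiple of its inverse. For such \<open>f\<close> and \<open>g\<close> the
  product is a multiple of a Weyl translation, an invertible isometry up to scaling.
\<close>

subsection \<open>Invariance of Lebesgue measure\<close>

lemma nn_integral_lborel_plus:
  fixes c :: "'a::euclidean_space"
  assumes [measurable]: "f \<in> borel_measurable borel"
  shows "(\<integral>\<^sup>+ x. f (c + x) \<partial>lborel) = (\<integral>\<^sup>+ x. f x \<partial>lborel)"
proof -
  have "(\<integral>\<^sup>+ x. f x \<partial>lborel) = (\<integral>\<^sup>+ x. f x \<partial>distr lborel borel ((+) c))"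
    by (simp add: lborel_distr_plus)
  also have "\<dots> = (\<integral>\<^sup>+ x. f (c + x) \<partial>lborel)"
    by (rule nn_integral_distr) simp_all
  finally show ?thesis ..
qed

lemma lborel_distr_minus:
  fixes c :: "'a::euclidean_space"
  shows "distr lborel borel ((-) c) = lborel"
  by (subst lborel_affine[of "-1" c]) (simp_all add: density_1)

lemma nn_integral_lborel_minus:
  fixes c :: "'a::euclidean_space"
  assumes [measurable]: "f \<in> borel_measurable borel"
  shows "(\<integral>\<^sup>+ x. f (c - x) \<partial>lborel) = (\<integral>\<^sup>+ x. f x \<partial>lborel)"
proof -
  have "(\<integral>\<^sup>+ x. f x \<partial>lborel) = (\<integral>\<^sup>+ x. f x \<partial>distr lborel borel ((-) c))"
    by (simp add: lborel_distr_minus)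
  also have "\<dots> = (\<integral>\<^sup>+ x. f (c - x) \<partial>lborel)"
    by (rule nn_integral_distr) simp_all
  finally show ?thesis ..
qed

text \<open>
  Uniqueness of Haar measure for this special case: test against the indicator of the unit ball, which \<open>R\<close>
  preserves, and exchange integrals.
\<close>
lemma nn_integral_lborel_isometry:
  fixes R :: "'a::euclidean_space \<Rightarrow> 'a"
  assumes "linear R" and norm_R: "\<And>x. norm (R x) = norm x"
    and [measurable]: "f \<in> borel_measurable borel"
  shows "(\<integral>\<^sup>+ x. f (R x) \<partial>lborel) = (\<integral>\<^sup>+ x. f x \<partial>lborel)"
proof -
  define b :: "'a \<Rightarrow> ennreal" where "b = indicator (ball 0 1)"
  have [measurable]: "b \<in> borel_measurable borel"
    unfolding b_def by (intro borel_measurable_indicator) simp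
  have b_R: "b (R x) = b x" for x
    by (simp add: b_def indicator_def norm_R)
  have [measurable]: "R \<in> borel_measurable borel"
    using \<open>linear R\<close> by (intro borel_measurable_continuous_onI linear_continuous_on)
      (simp add: linear_conv_bounded_linear)
  have "inj R"
    using \<open>linear R\<close> norm_R by (subst linear_injective_0) (auto, metis norm_eq_zero)
  then have surj_R: "surj R"
    using \<open>linear R\<close> linear_injective_imp_surjective by blast
  have "(\<integral>\<^sup>+ x. f (R x) \<partial>lborel) * (\<integral>\<^sup>+ y. b y \<partial>lborel) = (\<integral>\<^sup>+ x. (\<integral>\<^sup>+ y. f (R x) * b y \<partial>lborel) \<partial>lborel)"
    by (simp add: nn_integral_cmult nn_integral_multc)
  also have "\<dots> = (\<integral>\<^sup>+ x. (\<integral>\<^sup>+ y. f (R x) * b (R x + y) \<partial>lborel) \<partial>lborel)"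
    by (simp add: nn_integral_cmult nn_integral_lborel_plus)
  also have "\<dots> = (\<integral>\<^sup>+ y. (\<integral>\<^sup>+ x. f (R x) * b (R x + y) \<partial>lborel) \<partial>lborel)"
    by (rule lborel_pair.Fubini') simp
  also have "\<dots> = (\<integral>\<^sup>+ y. (\<integral>\<^sup>+ x. f (R x - y) * b (R x) \<partial>lborel) \<partial>lborel)"
  proof (rule nn_integral_cong)
    fix y
    obtain y' where y: "y = R y'" using surj_R by blast
    have "(\<integral>\<^sup>+ x. f (R (- y' + x)) * b (R (- y' + x) + y) \<partial>lborel) = (\<integral>\<^sup>+ x. f (R x) * b (R x + y) \<partial>lborel)"
      by (rule nn_integral_lborel_plus[where f = "\<lambda>x. f (R x) * b (R x + y)"]) simp
    moreover have "R (- y' + x) = R x - y" for x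
      using \<open>linear R\<close> by (simp add: y linear_diff flip: diff_conv_add_uminus add.commute)
    ultimately show "(\<integral>\<^sup>+ x. f (R x) * b (R x + y) \<partial>lborel) = (\<integral>\<^sup>+ x. f (R x - y) * b (R x) \<partial>lborel)"
      by simp
  qed
  also have "\<dots> = (\<integral>\<^sup>+ x. (\<integral>\<^sup>+ y. f (R x - y) * b (R x) \<partial>lborel) \<partial>lborel)"
    by (rule lborel_pair.Fubini') simp
  also have "\<dots> = (\<integral>\<^sup>+ x. f x \<partial>lborel) * (\<integral>\<^sup>+ y. b y \<partial>lborel)"
    by (simp add: nn_integral_cmult nn_integral_multc nn_integral_lborel_minus b_R)
  finally have "(\<integral>\<^sup>+ y. b y \<partial>lborel) * (\<integral>\<^sup>+ x. f (R x) \<partial>lborel) = (\<integral>\<^sup>+ y. b y \<partial>lborel) * (\<integral>\<^sup>+ x. f x \<partial>lborel)"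
    by (simp add: mult.commute)
  moreover have "(\<integral>\<^sup>+ y. b y \<partial>lborel) = emeasure lborel (ball 0 1 :: 'a set)"
    by (simp add: b_def)
  moreover have "emeasure lborel (ball 0 1 :: 'a set) \<noteq> 0"
    using content_ball_pos[of 1 "0::'a"] by (auto simp: measure_def)
  moreover have "emeasure lborel (ball 0 1 :: 'a set) \<noteq> \<infinity>"
    using emeasure_lborel_ball_finite[of 0 1] by (simp add: less_top)
  ultimately show ?thesis
    by (simp add: ennreal_mult_cancel_left)
qed

lemma lborel_distr_isometry:
  fixes R :: "'a::euclidean_space \<Rightarrow> 'a"
  assumes "linear R" and "\<And>x. norm (R x) = norm x"
  shows "distr lborel borel R = lborel"
proof (rule measure_eqI)
  fix A assume "A \<in> sets (distr lborel borel R)"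
  then have A [measurable]: "A \<in> sets borel" by simp
  have [measurable]: "R \<in> borel_measurable borel"
    using \<open>linear R\<close> by (intro borel_measurable_continuous_onI linear_continuous_on)
      (simp add: linear_conv_bounded_linear)
  have "emeasure (distr lborel borel R) A = (\<integral>\<^sup>+ x. indicator A x \<partial>distr lborel borel R)"
    by simp
  also have "\<dots> = (\<integral>\<^sup>+ x. indicator A (R x) \<partial>lborel)"
    by (rule nn_integral_distr) simp_all
  also have "\<dots> = (\<integral>\<^sup>+ x. indicator A x \<partial>lborel)"
    by (rule nn_integral_lborel_isometry[OF assms]) simp
  finally show "emeasure (distr lborel borel R) A = emeasure lborel A" by simp
qed simp

definition rot :: "real \<Rightarrow> complex ^ 'n \<Rightarrow> complex ^ 'n" where
  "rot t v = cis (2 * pi * t) *s v"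

definition turn_measure :: "real measure" where
  "turn_measure = density lborel (indicator {0..1})"

lemma norm_smult: "norm (c *s v) = norm c * norm v" for v :: "complex ^ 'n"
  by (simp add: norm_vec_def norm_mult L2_set_right_distrib)

lemma norm_rot [simp]: "norm (rot t v) = norm v"
  by (simp add: rot_def norm_smult)

lemma linear_rot: "linear (rot t)"
  by (intro linearI) (simp_all add: rot_def vec_eq_iff algebra_simps scaleR_conv_of_real)

lemma continuous_smult:
  fixes f :: "'a::topological_space \<Rightarrow> complex" and g :: "'a \<Rightarrow> complex ^ 'n"
  assumes "continuous_on S f" "continuous_on S g"
  shows "continuous_on S (\<lambda>x. f x *s g x)"
  unfolding vector_scalar_mult_def using assms by (intro continuous_intros)

lemma measurable_rot [measurable]:
  "(\<lambda>(t, v). rot t v :: complex ^ 'n) \<in> borel_measurable (borel \<Otimes>\<^sub>M borel)"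
proof -
  have "continuous_on UNIV (\<lambda>x :: real \<times> (complex ^ 'n). cis (2 * pi * fst x) *s snd x)"
    by (intro continuous_smult) (auto simp: cis_conv_exp intro!: continuous_intros)
  then show ?thesis
    by (subst borel_prod) (auto simp: rot_def case_prod_unfold intro!: borel_measurable_continuous_onI)
qed

lemma measurable_rot1 [measurable]: "rot t \<in> borel_measurable borel"
  using linear_rot by (intro borel_measurable_continuous_onI linear_continuous_on)
      (simp add: linear_conv_bounded_linear)

lemma sets_turn_measure [measurable_cong, simp]: "sets turn_measure = sets borel"
  by (simp add: turn_measure_def)

interpretation turn: prob_space turn_measure
  by (rule prob_spaceI) (simp add: turn_measure_def emeasure_density)

interpretation turn_lborel: pair_sigma_finite turn_measure lborel ..

lemma turn_measure_integral:
  fixes f :: "real \<Rightarrow> 'b::euclidean_space"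
  assumes "continuous_on UNIV f"
  shows "integrable turn_measure f" and "(\<integral> t. f t \<partial>turn_measure) = integral {0..1} f"
proof -
  have [measurable]: "f \<in> borel_measurable borel"
    using assms by (rule borel_measurable_continuous_onI)
  have "set_integrable lborel {0..1} f"
    by (rule borel_integrable_atLeastAtMost') (use assms continuous_on_subset in blast)
  then have *: "integrable lborel (\<lambda>t. indicator {0..1::real} t *\<^sub>R f t)"
    by (simp add: set_integrable_def)
  have d: "turn_measure = density lborel (\<lambda>t. ennreal (indicator {0..1} t))"
    by (simp add: turn_measure_def ennreal_indicator)
  show "integrable turn_measure f"
    unfolding d using * by (subst integrable_density) auto
  have "(\<integral> t. f t \<partial>turn_measure) = (LINT t:{0..1}|lborel. f t)"
    unfolding d set_lebesgue_integral_def by (subst integral_density) auto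
  also have "\<dots> = integral {0..1} f"
    by (rule set_borel_integral_eq_integral) fact
  finally show "(\<integral> t. f t \<partial>turn_measure) = integral {0..1} f" .
qed

lemma nn_integral_rot_average:
  fixes f :: "complex ^ 'n \<Rightarrow> ennreal"
  assumes [measurable]: "f \<in> borel_measurable borel"
  shows "(\<integral>\<^sup>+ v. (\<integral>\<^sup>+ t. f (rot t v) \<partial>turn_measure) \<partial>lborel) = (\<integral>\<^sup>+ v. f v \<partial>lborel)"
proof -
  have "(\<integral>\<^sup>+ v. (\<integral>\<^sup>+ t. f (rot t v) \<partial>turn_measure) \<partial>lborel)
      = (\<integral>\<^sup>+ t. (\<integral>\<^sup>+ v. f (rot t v) \<partial>lborel) \<partial>turn_measure)"
    by (rule turn_lborel.Fubini') measurable
  also have "\<dots> = (\<integral>\<^sup>+ t. (\<integral>\<^sup>+ v. f v \<partial>lborel) \<partial>turn_measure)"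
    by (simp add: nn_integral_lborel_isometry linear_rot)
  finally show ?thesis
    using turn.emeasure_space_1 by simp
qed

lemma integral_rot_average:
  fixes f :: "complex ^ 'n \<Rightarrow> complex"
  assumes f: "integrable lborel f"
  shows "(\<integral> v. (\<integral> t. f (rot t v) \<partial>turn_measure) \<partial>lborel) = (\<integral> v. f v \<partial>lborel)"
proof -
  have [measurable]: "f \<in> borel_measurable borel"
    using f by simp
  have rot_f: "integrable lborel (\<lambda>v. f (rot t v))"
      "(\<integral> v. f (rot t v) \<partial>lborel) = (\<integral> v. f v \<partial>lborel)"
      "(\<integral> v. norm (f (rot t v)) \<partial>lborel) = (\<integral> v. norm (f v) \<partial>lborel)" for t
  proof -
    have d: "distr lborel borel (rot t) = (lborel :: (complex ^ 'n) measure)"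
      by (simp add: lborel_distr_isometry linear_rot)
    show "integrable lborel (\<lambda>v. f (rot t v))"
      using f by (subst (asm) d[symmetric]) (subst (asm) integrable_distr_eq; simp)
    show "(\<integral> v. f (rot t v) \<partial>lborel) = (\<integral> v. f v \<partial>lborel)"
      by (subst (2) d[symmetric]) (subst integral_distr; simp)
    show "(\<integral> v. norm (f (rot t v)) \<partial>lborel) = (\<integral> v. norm (f v) \<partial>lborel)"
      by (subst (2) d[symmetric]) (subst integral_distr; simp)
  qed
  have "integrable (turn_measure \<Otimes>\<^sub>M lborel) (\<lambda>(t, v). f (rot t v))"
    by (rule turn_lborel.Fubini_integrable) (simp_all add: rot_f)
  from turn_lborel.Fubini_integral[OF this] show ?thesis
    using turn.prob_space by (simp add: rot_f)
qed

subsection \<open>Entire functions and Gaussian means\<close>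

lemma entire_imp_continuous: "entire F \<Longrightarrow> continuous_on S F"
  unfolding entire_def by (meson continuous_at_imp_continuous_on has_derivative_continuous)

lemma entire_measurable [measurable_dest]: "entire F \<Longrightarrow> F \<in> borel_measurable borel"
  by (intro borel_measurable_continuous_onI entire_imp_continuous)

lemma bounded_linear_smult_left: "bounded_linear (\<lambda>t. t *s (v :: complex ^ 'n))"
  unfolding linear_conv_bounded_linear[symmetric]
  by (intro linearI) (simp_all add: vec_eq_iff algebra_simps)

lemma entire_line_has_field_derivative:
  fixes v :: "complex ^ 'n"
  assumes D: "(F has_derivative D) (at (z + t *s v))" and lin: "\<And>c v. D (c *s v) = c * D v"
  shows "((\<lambda>t. F (z + t *s v)) has_field_derivative D v) (at t)"
proof -
  have "((\<lambda>t. z + t *s v) has_derivative (\<lambda>h. h *s v)) (at t)"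
    using bounded_linear_imp_has_derivative[OF bounded_linear_smult_left[of v]]
    by (auto intro!: derivative_eq_intros)
  from diff_chain_at[OF this D]
  have "((\<lambda>t. F (z + t *s v)) has_derivative (\<lambda>h. h * D v)) (at t)"
    by (simp add: o_def lin)
  moreover have "(\<lambda>h. h * D v) = (*) (D v)"
    by (simp add: fun_eq_iff mult.commute)
  ultimately show ?thesis
    by (simp add: has_field_derivative_def)
qed

lemma entire_holomorphic_line:
  assumes "entire F"
  shows "(\<lambda>t. F (z + t *s v)) holomorphic_on S"
proof (rule holomorphic_onI)
  fix t
  obtain D where "(F has_derivative D) (at (z + t *s v))" "\<And>c v. D (c *s v) = c * D v"
    using assms unfolding entire_def by blast
  then show "(\<lambda>t. F (z + t *s v)) field_differentiable (at t within S)"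
    using entire_line_has_field_derivative field_differentiable_at_within
      field_differentiable_def by blast
qed

lemma continuous_on_rot: "continuous_on S (\<lambda>t. rot t v)"
  unfolding rot_def by (intro continuous_smult) (auto simp: cis_conv_exp intro!: continuous_intros)

lemma entire_rot_mean:
  assumes "entire F"
  shows "(\<integral> t. F (z + rot t v) \<partial>turn_measure) = F z"
proof -
  have "((\<lambda>u. F (z + u *s v) / (u - 0)) has_contour_integral (2 * of_real pi * \<i> * F (z + 0 *s v))) (circlepath 0 1)"
    by (rule Cauchy_integral_circlepath_simple) (auto intro: entire_holomorphic_line[OF assms])
  then have "((\<lambda>t. 2 * of_real pi * \<i> * F (z + rot t v)) has_integral (2 * of_real pi * \<i> * F z)) {0..1}"
    by (simp add: has_contour_integral vector_derivative_circlepath)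
      (simp add: circlepath rot_def cis_conv_exp mult_ac)
  from has_integral_mult_right[OF this, of "1 / (2 * of_real pi * \<i>)"]
  have "((\<lambda>t. F (z + rot t v)) has_integral F z) {0..1}"
    by simp
  moreover have "continuous_on UNIV (\<lambda>t. F (z + rot t v))"
    by (rule continuous_on_compose2[OF entire_imp_continuous[OF assms, of UNIV]])
      (auto intro!: continuous_intros continuous_on_rot)
  ultimately show ?thesis
    using integral_unique turn_measure_integral(2) by metis
qed

lemma powr_tangent_le:
  fixes a x p :: real
  assumes "p > 1" "a \<ge> 0" "x \<ge> 0"
  shows "p * a powr (p - 1) * x - (p - 1) * a powr p \<le> x powr p"
proof -
  define q where "q = p / (p - 1)"
  have q: "q > 1" "1 / p + 1 / q = 1"
    using assms by (auto simp: q_def field_simps)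
  have "x * a powr (p - 1) \<le> x powr p / p + (a powr (p - 1)) powr q / q"
    using assms q by (intro Youngs_inequality) auto
  also have "(a powr (p - 1)) powr q = a powr p"
    using assms by (simp add: powr_powr q_def)
  finally have "p * (x * a powr (p - 1)) \<le> p * (x powr p / p + a powr p / q)"
    using assms by simp
  also have "\<dots> = x powr p + (p - 1) * a powr p"
    using assms by (simp add: q_def field_simps)
  finally show ?thesis by (simp add: mult_ac)
qed

lemma entire_rot_submean:
  assumes "entire F" "p > 1"
  shows "ennreal (norm (F z) powr p) \<le> (\<integral>\<^sup>+ t. ennreal (norm (F (z + rot t v)) powr p) \<partial>turn_measure)"
proof -
  define a where "a = norm (F z)"
  have cont: "continuous_on UNIV (\<lambda>t. F (z + rot t v))"
    by (rule continuous_on_compose2[OF entire_imp_continuous[OF assms(1), of UNIV]])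
      (auto intro!: continuous_intros continuous_on_rot)
  note cont_p = continuous_on_powr'[OF continuous_on_norm[OF cont] continuous_on_const[of UNIV p]]
  have int: "integrable turn_measure (\<lambda>t. norm (F (z + rot t v)))"
    "integrable turn_measure (\<lambda>t. norm (F (z + rot t v)) powr p)"
    using \<open>p > 1\<close> by (intro turn_measure_integral continuous_on_norm cont cont_p; simp)+
  have "a \<le> (\<integral> t. norm (F (z + rot t v)) \<partial>turn_measure)"
    unfolding a_def entire_rot_mean[OF assms(1), of z v, symmetric] by (rule integral_norm_bound)
  then have "p * a powr (p - 1) * a \<le> p * a powr (p - 1) * (\<integral> t. norm (F (z + rot t v)) \<partial>turn_measure)"
    using \<open>p > 1\<close> by (intro mult_left_mono) auto
  moreover have "a powr (p - 1) * a = a powr p"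
    using powr_mult_base[of a "p - 1"] by (simp add: a_def mult.commute)
  then have "p * a powr (p - 1) * a = p * a powr p"
    by (simp only: mult.assoc)
  ultimately have "a powr p \<le> p * a powr (p - 1) * (\<integral> t. norm (F (z + rot t v)) \<partial>turn_measure) - (p - 1) * a powr p"
    by (simp add: left_diff_distrib)
  also have "\<dots> = (\<integral> t. p * a powr (p - 1) * norm (F (z + rot t v)) - (p - 1) * a powr p \<partial>turn_measure)"
    using int turn.prob_space by simp
  also have "\<dots> \<le> (\<integral> t. norm (F (z + rot t v)) powr p \<partial>turn_measure)"
    using int by (intro integral_mono powr_tangent_le \<open>p > 1\<close>) (auto simp: a_def)
  finally have "ennreal (a powr p) \<le> ennreal \<dots>"
    by (rule ennreal_leI)
  also have "\<dots> = (\<integral>\<^sup>+ t. ennreal (norm (F (z + rot t v)) powr p) \<partial>turn_measure)"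
    using int by (intro nn_integral_eq_integral[symmetric]) auto
  finally show ?thesis by (simp add: a_def)
qed

lemma nn_integral_gauss_real:
  fixes \<beta> :: real
  assumes "\<beta> > 0"
  shows "(\<integral>\<^sup>+ x. ennreal (exp (- \<beta> * x\<^sup>2)) \<partial>lborel) = ennreal (sqrt (pi / \<beta>))"
proof -
  define s where "s = sqrt (1 / (2 * \<beta>))"
  have eq: "exp (- \<beta> * x\<^sup>2) = sqrt (pi / \<beta>) * normal_density 0 s x" for x
    using assms by (simp add: normal_density_def s_def real_sqrt_divide real_sqrt_mult
        power_divide power_mult_distrib)
  have "s > 0" using assms by (simp add: s_def)
  then have "(\<integral>\<^sup>+ x. ennreal (normal_density 0 s x) \<partial>lborel) = 1"
    by (simp add: nn_integral_eq_integral normal_density_nonneg)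
  then show ?thesis
    using assms unfolding eq by (simp add: ennreal_mult' nn_integral_cmult normal_density_nonneg)
qed

lemma nn_integral_gauss:
  assumes "\<beta> > 0"
  shows "(\<integral>\<^sup>+ v. ennreal (exp (- \<beta> * (norm (v :: complex ^ 'n))\<^sup>2)) \<partial>lborel) = ennreal ((pi / \<beta>) ^ CARD('n))"
proof -
  have "exp (- \<beta> * (norm v)\<^sup>2) = (\<Prod>b\<in>Basis. exp (- \<beta> * (v \<bullet> b)\<^sup>2))" for v :: "complex ^ 'n"
    unfolding power2_norm_eq_inner euclidean_inner[of v v]
    by (simp add: power2_eq_square exp_sum sum_distrib_left flip: sum_negf)
  then have "(\<integral>\<^sup>+ v. ennreal (exp (- \<beta> * (norm (v :: complex ^ 'n))\<^sup>2)) \<partial>lborel)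
      = (\<integral>\<^sup>+ v. (\<Prod>b\<in>Basis. ennreal (exp (- \<beta> * ((v :: complex ^ 'n) \<bullet> b)\<^sup>2))) \<partial>lborel)"
    by (simp add: prod_ennreal)
  also have "\<dots> = (\<Prod>b\<in>(Basis :: (complex ^ 'n) set). (\<integral>\<^sup>+ x. ennreal (exp (- \<beta> * x\<^sup>2)) \<partial>lborel))"
    by (rule nn_integral_lborel_prod) auto
  also have "\<dots> = ennreal (sqrt (pi / \<beta>) ^ (2 * CARD('n)))"
    using assms by (simp only: nn_integral_gauss_real) (simp add: ennreal_power mult.commute)
  finally show ?thesis
    using assms by (simp add: power_mult)
qed

lemma integrable_gauss:
  assumes "\<beta> > 0"
  shows "integrable lborel (\<lambda>v :: complex ^ 'n. exp (- \<beta> * (norm v)\<^sup>2))"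
    and "(\<integral> v. exp (- \<beta> * (norm (v :: complex ^ 'n))\<^sup>2) \<partial>lborel) = (pi / \<beta>) ^ CARD('n)"
  using nn_integral_eq_integrable[of "\<lambda>v :: complex ^ 'n. exp (- \<beta> * (norm v)\<^sup>2)" lborel "(pi / \<beta>) ^ CARD('n)"]
    nn_integral_gauss[OF assms, where 'n = 'n] assms
  by auto

lemma entire_gauss_mean:
  fixes F :: "complex ^ 'n \<Rightarrow> complex"
  assumes "entire F" "\<beta> > 0"
    and int: "integrable lborel (\<lambda>v. F (z + v) * of_real (exp (- \<beta> * (norm v)\<^sup>2)))"
  shows "(\<integral> v. F (z + v) * of_real (exp (- \<beta> * (norm v)\<^sup>2)) \<partial>lborel) = of_real ((pi / \<beta>) ^ CARD('n)) * F z"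
proof -
  have "(\<integral> v. F (z + v) * of_real (exp (- \<beta> * (norm v)\<^sup>2)) \<partial>lborel)
      = (\<integral> v. (\<integral> t. F (z + rot t v) * of_real (exp (- \<beta> * (norm (rot t v))\<^sup>2)) \<partial>turn_measure) \<partial>lborel)"
    by (rule integral_rot_average[OF int, symmetric])
  also have "\<dots> = (\<integral> v. F z * of_real (exp (- \<beta> * (norm (v :: complex ^ 'n))\<^sup>2)) \<partial>lborel)"
    using entire_rot_mean[OF assms(1)] by simp
  also have "\<dots> = F z * of_real (\<integral> v. exp (- \<beta> * (norm (v :: complex ^ 'n))\<^sup>2) \<partial>lborel)"
    by simp
  finally show ?thesis
    using integrable_gauss(2)[OF \<open>\<beta> > 0\<close>, where 'n = 'n] by simp
qed

lemma heat_transform_shift: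
  assumes [measurable]: "h \<in> borel_measurable borel"
  shows "heat_transform \<beta> h z = ennreal ((\<beta> / pi) ^ CARD('n)) *
     (\<integral>\<^sup>+ v. ennreal (exp (- \<beta> * (norm (v :: complex ^ 'n))\<^sup>2) * h (z + v)) \<partial>lborel)"
proof -
  have "(\<integral>\<^sup>+ v. ennreal (exp (- \<beta> * (norm (z - (z + v)))\<^sup>2) * h (z + v)) \<partial>lborel)
    = (\<integral>\<^sup>+ v. ennreal (exp (- \<beta> * (norm (z - v))\<^sup>2) * h v) \<partial>lborel)"
    by (rule nn_integral_lborel_plus) measurable
  then show ?thesis by (simp add: heat_transform_def)
qed

lemma heat_transform_ge:
  fixes F :: "complex ^ 'n \<Rightarrow> complex"
  assumes "entire F" "p > 1" "\<beta> > 0"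
  shows "ennreal (norm (F z) powr p) \<le> heat_transform \<beta> (\<lambda>u. norm (F u) powr p) z"
proof -
  note [measurable] = entire_measurable[OF assms(1)]
  have "ennreal (norm (F z) powr p) * ennreal ((pi / \<beta>) ^ CARD('n))
      = (\<integral>\<^sup>+ v. ennreal (exp (- \<beta> * (norm (v :: complex ^ 'n))\<^sup>2)) * ennreal (norm (F z) powr p) \<partial>lborel)"
    using nn_integral_gauss[OF \<open>\<beta> > 0\<close>, where 'n = 'n] by (subst nn_integral_multc) (simp_all add: mult.commute)
  also have "\<dots> \<le> (\<integral>\<^sup>+ v. (\<integral>\<^sup>+ t. ennreal (exp (- \<beta> * (norm (rot t v))\<^sup>2) * norm (F (z + rot t v)) powr p) \<partial>turn_measure) \<partial>lborel)"
  proof (rule nn_integral_mono)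
    fix v :: "complex ^ 'n"
    have "ennreal (exp (- \<beta> * (norm v)\<^sup>2)) * ennreal (norm (F z) powr p)
        \<le> ennreal (exp (- \<beta> * (norm v)\<^sup>2)) * (\<integral>\<^sup>+ t. ennreal (norm (F (z + rot t v)) powr p) \<partial>turn_measure)"
      by (intro mult_left_mono entire_rot_submean assms) auto
    also have "\<dots> = (\<integral>\<^sup>+ t. ennreal (exp (- \<beta> * (norm (rot t v))\<^sup>2) * norm (F (z + rot t v)) powr p) \<partial>turn_measure)"
      by (subst nn_integral_cmult[symmetric]) (auto simp: ennreal_mult)
    finally show "ennreal (exp (- \<beta> * (norm v)\<^sup>2)) * ennreal (norm (F z) powr p) \<le> \<dots>" .
  qed
  also have "\<dots> = (\<integral>\<^sup>+ v. ennreal (exp (- \<beta> * (norm v)\<^sup>2) * norm (F (z + v)) powr p) \<partial>lborel)"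
    by (rule nn_integral_rot_average) measurable
  finally have "ennreal ((\<beta> / pi) ^ CARD('n)) * (ennreal (norm (F z) powr p) * ennreal ((pi / \<beta>) ^ CARD('n)))
      \<le> heat_transform \<beta> (\<lambda>u. norm (F u) powr p) z"
    by (subst heat_transform_shift) (auto intro!: mult_left_mono)
  moreover have "ennreal ((\<beta> / pi) ^ CARD('n)) * (ennreal (norm (F z) powr p) * ennreal ((pi / \<beta>) ^ CARD('n)))
      = ennreal (norm (F z) powr p)"
    using \<open>\<beta> > 0\<close> by (simp add: power_divide flip: ennreal_mult)
  ultimately show ?thesis by simp
qed

lemma heat_transform_ge_shift:
  fixes F :: "complex ^ 'n \<Rightarrow> complex"
  assumes "entire F" "p > 1" "\<beta> > 0"
  shows "ennreal (norm (F (z + w)) powr p)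
    \<le> ennreal (2 ^ CARD('n) * exp (2 * \<beta> * (norm w)\<^sup>2)) * heat_transform \<beta> (\<lambda>u. norm (F u) powr p) z"
proof -
  note [measurable] = entire_measurable[OF assms(1)]
  define h where "h u = norm (F u) powr p" for u
  have [measurable]: "h \<in> borel_measurable borel" unfolding h_def by measurable
  have h: "h u \<ge> 0" for u by (simp add: h_def)
  have *: "exp (- (2 * \<beta>) * (norm (z + w - u))\<^sup>2) \<le> exp (2 * \<beta> * (norm w)\<^sup>2) * exp (- \<beta> * (norm (z - u))\<^sup>2)" for u
  proof -
    define a where "a = z + w - u"
    have "0 \<le> (norm (a + w))\<^sup>2"
      by simp
    also have "\<dots> = 2 * (norm a)\<^sup>2 + 2 * (norm w)\<^sup>2 - (norm (a - w))\<^sup>2"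
      unfolding power2_norm_eq_inner by (simp add: inner_diff inner_add inner_commute[of a w])
    also have "a - w = z - u" by (simp add: a_def)
    finally have "\<beta> * (norm (z - u))\<^sup>2 \<le> \<beta> * (2 * (norm (z + w - u))\<^sup>2 + 2 * (norm w)\<^sup>2)"
      using \<open>\<beta> > 0\<close> by (intro mult_left_mono) (auto simp: a_def)
    then show ?thesis
      unfolding exp_add[symmetric] exp_le_cancel_iff by (simp add: algebra_simps)
  qed
  have "ennreal (h (z + w)) \<le> heat_transform (2 * \<beta>) h (z + w)"
    using heat_transform_ge[of F p "2 * \<beta>" "z + w"] assms by (simp add: h_def[abs_def])
  also have "\<dots> \<le> ennreal ((2 * \<beta> / pi) ^ CARD('n)) *
      (\<integral>\<^sup>+ u. ennreal (exp (2 * \<beta> * (norm w)\<^sup>2)) * ennreal (exp (- \<beta> * (norm (z - u))\<^sup>2) * h u) \<partial>lborel)"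
    unfolding heat_transform_def using * h \<open>\<beta> > 0\<close>
    by (intro mult_left_mono nn_integral_mono)
      (auto simp flip: ennreal_mult mult.assoc intro!: ennreal_leI mult_right_mono)
  also have "\<dots> = ennreal (2 ^ CARD('n) * exp (2 * \<beta> * (norm w)\<^sup>2)) * heat_transform \<beta> h z"
  proof -
    have "ennreal ((2 * \<beta> / pi) ^ CARD('n)) = ennreal (2 ^ CARD('n)) * ennreal ((\<beta> / pi) ^ CARD('n))"
      using \<open>\<beta> > 0\<close> by (simp flip: ennreal_mult add: power_mult_distrib power_divide)
    then show ?thesis
      by (simp add: heat_transform_def nn_integral_cmult ennreal_mult mult_ac)
  qed
  finally show ?thesis by (simp add: h_def[abs_def])
qed

subsection \<open>Fock spaces and the reproducing formula\<close>

lemma Re_hdot: "Re (hdot z u) = z \<bullet> u"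
  by (simp add: hdot_def inner_vec_def inner_complex_def)

lemma cnj_hdot: "cnj (hdot z u) = hdot u z"
  by (simp add: hdot_def mult.commute)

lemma hdot_add_left: "hdot (a + b) u = hdot a u + hdot b u"
  and hdot_diff_left: "hdot (a - b) u = hdot a u - hdot b u"
  and hdot_smult_left: "hdot (c *s a) u = c * hdot a u"
  and hdot_add_right: "hdot u (a + b) = hdot u a + hdot u b"
  and hdot_uminus_right: "hdot u (- a) = - hdot u a"
  by (simp_all add: hdot_def algebra_simps sum.distrib sum_subtractf sum_distrib_left sum_negf)

lemma hdot_self: "hdot u u = of_real ((norm u)\<^sup>2)"
proof -
  have "Im (hdot u u) = 0"
    using cnj_hdot[of u u] by (simp add: complex_eq_iff)
  then show ?thesis
    by (simp add: complex_eq_iff Re_hdot power2_norm_eq_inner)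
qed

lemma norm_exp_hdot: "norm (exp (of_real \<alpha> * hdot u w)) = exp (\<alpha> * (u \<bullet> w))"
  by (simp add: Re_hdot)

lemma bounded_linear_hdot: "bounded_linear (\<lambda>z. hdot z u)"
  unfolding linear_conv_bounded_linear[symmetric]
  by (intro linearI)
    (simp_all add: hdot_def algebra_simps sum.distrib scaleR_sum_right)

lemma continuous_on_hdot_right: "continuous_on S (\<lambda>u. hdot z u)"
  unfolding hdot_def by (intro continuous_intros)

lemma measurable_hdot_right [measurable]: "(\<lambda>u. hdot z u) \<in> borel_measurable borel"
  by (intro borel_measurable_continuous_onI continuous_on_hdot_right)

lemma measurable_hdot_left [measurable]: "(\<lambda>u. hdot u z) \<in> borel_measurable borel"
  by (intro borel_measurable_continuous_onI linear_continuous_on bounded_linear_hdot)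

lemma entireI:
  assumes "\<And>z. (F has_derivative D z) (at z)" "\<And>z c v. D z (c *s v) = c * D z v"
  shows "entire F"
  using assms unfolding entire_def by blast

lemma entire_const [simp]: "entire (\<lambda>z. c)"
  by (rule entireI[where D = "\<lambda>_ _. 0"]) auto

lemma entire_hdot: "entire (\<lambda>z. hdot z u)"
  by (rule entireI[where D = "\<lambda>_ v. hdot v u"])
    (auto simp: hdot_smult_left intro: bounded_linear_imp_has_derivative bounded_linear_hdot)

lemma entire_add:
  assumes "entire F" "entire G"
  shows "entire (\<lambda>z. F z + G z)"
proof -
  obtain D E where "\<And>z. (F has_derivative D z) (at z)" "\<And>z c v. D z (c *s v) = c * D z v"
    "\<And>z. (G has_derivative E z) (at z)" "\<And>z c v. E z (c *s v) = c * E z v"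
    using assms unfolding entire_def by metis
  then show ?thesis
    by (intro entireI[where D = "\<lambda>z v. D z v + E z v"] has_derivative_add) (auto simp: algebra_simps)
qed

lemma entire_mult:
  assumes "entire F" "entire G"
  shows "entire (\<lambda>z. F z * G z)"
proof -
  obtain D E where "\<And>z. (F has_derivative D z) (at z)" "\<And>z c v. D z (c *s v) = c * D z v"
    "\<And>z. (G has_derivative E z) (at z)" "\<And>z c v. E z (c *s v) = c * E z v"
    using assms unfolding entire_def by metis
  then show ?thesis
    by (intro entireI[where D = "\<lambda>z v. F z * E z v + D z v * G z"] has_derivative_mult)
      (auto simp: algebra_simps)
qed

lemma entire_exp:
  assumes "entire F"
  shows "entire (\<lambda>z. exp (F z))"
proof -
  obtain D where D: "\<And>z. (F has_derivative D z) (at z)" "\<And>z c v. D z (c *s v) = c * D z v"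
    using assms unfolding entire_def by metis
  have "((\<lambda>z. exp (F z)) has_derivative (\<lambda>v. exp (F z) * D z v)) (at z)" for z
    using diff_chain_at[OF D(1)[of z] DERIV_exp[unfolded has_field_derivative_def]] by (simp add: o_def)
  then show ?thesis
    by (rule entireI) (simp add: D(2))
qed

lemma entire_shift:
  assumes "entire F"
  shows "entire (\<lambda>z. F (z + w))"
proof -
  obtain D where D: "\<And>z. (F has_derivative D z) (at z)" "\<And>z c v. D z (c *s v) = c * D z v"
    using assms unfolding entire_def by metis
  have "((\<lambda>z. F (z + w)) has_derivative D (z + w)) (at z)" for z
  proof -
    have "((\<lambda>z. z + w) has_derivative (\<lambda>v. v)) (at z)"
      by (auto intro!: derivative_eq_intros)
    from diff_chain_at[OF this D(1)] show ?thesis by (simp add: o_def)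
  qed
  then show ?thesis
    by (rule entireI) (simp add: D(2))
qed

lemma entire_sum: "(\<And>i. i \<in> I \<Longrightarrow> entire (F i)) \<Longrightarrow> entire (\<lambda>z. \<Sum>i\<in>I. F i z)"
  by (induction I rule: infinite_finite_induct) (auto intro: entire_add)

lemma entire_normalized_kernel: "entire (normalized_kernel \<alpha> z)"
  unfolding normalized_kernel_def[abs_def] diff_conv_add_uminus
  by (intro entire_exp entire_add entire_mult entire_hdot entire_const)

lemma fock_spaceD:
  assumes "f \<in> fock_space \<alpha> p"
  shows "entire f" "integrable lborel (\<lambda>z. (norm (f z) * exp (- (\<alpha> / 2) * (norm z)\<^sup>2)) powr p)"
  using assms by (auto simp: fock_space_def)

lemma fock_spaceI_growth:
  fixes h :: "complex ^ 'n \<Rightarrow> complex"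
  assumes "entire h" "\<alpha> > 0" "p > 0" and growth: "\<And>u. norm (h u) \<le> M * exp (L * norm u)"
  shows "h \<in> fock_space \<alpha> p"
proof -
  note [measurable] = entire_measurable[OF assms(1)]
  define K where "K = M * exp (L\<^sup>2 / \<alpha>)"
  have "M \<ge> 0"
    using order_trans[OF norm_ge_zero growth[of 0]] by simp
  have le: "norm (h u) * exp (- (\<alpha> / 2) * (norm u)\<^sup>2) \<le> K * exp (- (\<alpha> / 4) * (norm u)\<^sup>2)" for u
  proof -
    have "0 \<le> (\<alpha> * norm u - 2 * L)\<^sup>2 / (4 * \<alpha>)"
      using \<open>\<alpha> > 0\<close> by simp
    also have "\<dots> = L\<^sup>2 / \<alpha> + (\<alpha> / 4) * (norm u)\<^sup>2 - L * norm u"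
      using \<open>\<alpha> > 0\<close> by (simp add: field_simps power2_eq_square)
    finally have "L * norm u - (\<alpha> / 2) * (norm u)\<^sup>2 \<le> L\<^sup>2 / \<alpha> - (\<alpha> / 4) * (norm u)\<^sup>2"
      by simp
    then have "M * exp (L * norm u - (\<alpha> / 2) * (norm u)\<^sup>2) \<le> M * exp (L\<^sup>2 / \<alpha> - (\<alpha> / 4) * (norm u)\<^sup>2)"
      using \<open>M \<ge> 0\<close> by (intro mult_left_mono) auto
    moreover have "norm (h u) * exp (- (\<alpha> / 2) * (norm u)\<^sup>2) \<le> M * exp (L * norm u) * exp (- (\<alpha> / 2) * (norm u)\<^sup>2)"
      by (intro mult_right_mono growth) auto
    moreover have "M * exp (L * norm u) * exp (- (\<alpha> / 2) * (norm u)\<^sup>2) = M * exp (L * norm u - (\<alpha> / 2) * (norm u)\<^sup>2)"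
      "K * exp (- (\<alpha> / 4) * (norm u)\<^sup>2) = M * exp (L\<^sup>2 / \<alpha> - (\<alpha> / 4) * (norm u)\<^sup>2)"
      by (simp_all add: K_def mult.assoc flip: exp_add)
    ultimately show ?thesis
      by linarith
  qed
  have "integrable lborel (\<lambda>u :: complex ^ 'n. K powr p * exp (- (\<alpha> * p / 4) * (norm u)\<^sup>2))"
    using assms by (intro integrable_mult_right integrable_gauss) auto
  then have "integrable lborel (\<lambda>u. (norm (h u) * exp (- (\<alpha> / 2) * (norm u)\<^sup>2)) powr p)"
  proof (rule Bochner_Integration.integrable_bound)
    have "(norm (h u) * exp (- (\<alpha> / 2) * (norm u)\<^sup>2)) powr p \<le> K powr p * exp (- (\<alpha> * p / 4) * (norm u)\<^sup>2)" for u
    proof -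
      have "(norm (h u) * exp (- (\<alpha> / 2) * (norm u)\<^sup>2)) powr p \<le> (K * exp (- (\<alpha> / 4) * (norm u)\<^sup>2)) powr p"
        using \<open>p > 0\<close> by (intro powr_mono2 le) auto
      then show ?thesis
        using \<open>M \<ge> 0\<close> by (simp add: powr_mult K_def exp_powr_real mult_ac)
    qed
    then show "AE u in lborel. norm ((norm (h u) * exp (- (\<alpha> / 2) * (norm u)\<^sup>2)) powr p)
        \<le> norm (K powr p * exp (- (\<alpha> * p / 4) * (norm u)\<^sup>2))"
      by simp
  qed measurable
  then show ?thesis
    using assms by (simp add: fock_space_def)
qed

lemma norm_normalized_kernel: "norm (normalized_kernel \<alpha> z u) = exp (\<alpha> * (u \<bullet> z) - \<alpha> / 2 * (norm z)\<^sup>2)"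
  by (simp add: normalized_kernel_def Re_hdot)

lemma norm_normalized_kernel_le:
  assumes "\<alpha> > 0"
  shows "norm (normalized_kernel \<alpha> z u) \<le> exp (\<alpha> * norm z * norm u)"
proof -
  have "\<alpha> * (u \<bullet> z) \<le> \<alpha> * (norm z * norm u)"
    using assms norm_cauchy_schwarz[of u z] by (intro mult_left_mono) (auto simp: mult.commute)
  moreover have "0 \<le> \<alpha> / 2 * (norm z)\<^sup>2"
    using assms by simp
  ultimately have "\<alpha> * (u \<bullet> z) - \<alpha> / 2 * (norm z)\<^sup>2 \<le> \<alpha> * norm z * norm u"
    by (simp only: mult.assoc)
  then show ?thesis
    by (simp add: norm_normalized_kernel)
qed

lemma kernel_span_subset_fock:
  assumes "\<alpha> > 0" "p > 0"
  shows "kernel_span \<alpha> \<subseteq> fock_space \<alpha> p"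
proof
  fix h :: "complex ^ 'n \<Rightarrow> complex"
  assume "h \<in> kernel_span \<alpha>"
  then obtain Z c where h: "h = (\<lambda>u. \<Sum>z\<in>Z. c z * normalized_kernel \<alpha> z u)" "finite Z"
    by (auto simp: kernel_span_def)
  define L where "L = \<alpha> * (\<Sum>z\<in>Z. norm z)"
  have "norm (h u) \<le> (\<Sum>z\<in>Z. norm (c z)) * exp (L * norm u)" for u
  proof -
    have "norm (h u) \<le> (\<Sum>z\<in>Z. norm (c z * normalized_kernel \<alpha> z u))"
      unfolding h by (rule norm_sum)
    also have "\<dots> \<le> (\<Sum>z\<in>Z. norm (c z) * exp (L * norm u))"
    proof (rule sum_mono)
      fix z assume "z \<in> Z"
      then have "norm z \<le> (\<Sum>z\<in>Z. norm z)"
        using \<open>finite Z\<close> by (intro member_le_sum) auto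
      then have "\<alpha> * norm z * norm u \<le> L * norm u"
        unfolding L_def using assms by (intro mult_right_mono mult_left_mono) auto
      then have "norm (normalized_kernel \<alpha> z u) \<le> exp (L * norm u)"
        by (intro order_trans[OF norm_normalized_kernel_le[OF \<open>\<alpha> > 0\<close>]]) simp
      then show "norm (c z * normalized_kernel \<alpha> z u) \<le> norm (c z) * exp (L * norm u)"
        by (simp add: norm_mult mult_left_mono)
    qed
    finally show ?thesis by (simp add: sum_distrib_right)
  qed
  moreover have "entire h"
    unfolding h(1) by (intro entire_sum entire_mult entire_const entire_normalized_kernel)
  ultimately show "h \<in> fock_space \<alpha> p"
    using assms fock_spaceI_growth by blast
qed

lemma normalized_kernel_in_span: "normalized_kernel \<alpha> z \<in> kernel_span \<alpha>"
  unfolding kernel_span_def by (rule CollectI, rule exI[of _ "{z}"], rule exI[of _ "\<lambda>_. 1"]) auto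

lemma integrable_fock_pairing:
  fixes \<phi> :: "complex ^ 'n \<Rightarrow> complex"
  assumes "p > 1" "1 / p + 1 / q = 1" and k: "k \<in> fock_space \<alpha> p" and g: "g \<in> fock_space \<alpha> q"
    and [measurable]: "\<phi> \<in> borel_measurable borel"
    and norm: "\<And>u. norm (\<phi> u) = norm (g u) * norm (k u) * exp (- \<alpha> * (norm u)\<^sup>2)"
  shows "integrable lborel \<phi>"
proof -
  have "q = p / (p - 1)"
    using assms(1,2) by (cases "q = 0") (auto simp: field_simps)
  then have "q > 1"
    using assms(1) by simp
  define e where "e u = exp (- (\<alpha> / 2) * (norm u)\<^sup>2)" for u :: "complex ^ 'n"
  have "integrable lborel (\<lambda>u. (norm (k u) * e u) powr p / p + (norm (g u) * e u) powr q / q)"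
    unfolding e_def using fock_spaceD(2)[OF k] fock_spaceD(2)[OF g] by auto
  then show ?thesis
  proof (rule Bochner_Integration.integrable_bound)
    have "norm (\<phi> u) \<le> (norm (k u) * e u) powr p / p + (norm (g u) * e u) powr q / q" for u
    proof -
      have "exp (- \<alpha> * (norm u)\<^sup>2) = e u * e u"
        by (simp add: e_def flip: exp_add)
      then have "norm (\<phi> u) = (norm (k u) * e u) * (norm (g u) * e u)"
        by (simp add: norm mult_ac)
      also have "\<dots> \<le> (norm (k u) * e u) powr p / p + (norm (g u) * e u) powr q / q"
        using assms \<open>q > 1\<close> by (intro Youngs_inequality) (auto simp: e_def)
      finally show ?thesis .
    qed
    then show "AE u in lborel. norm (\<phi> u) \<le> norm ((norm (k u) * e u) powr p / p + (norm (g u) * e u) powr q / q)"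
      by (intro always_eventually allI) (use abs_ge_self order_trans real_norm_def in metis)
  qed simp
qed

lemma lborel_plus:
  fixes \<phi> :: "'a::euclidean_space \<Rightarrow> 'b::{banach, second_countable_topology}"
  assumes [measurable]: "\<phi> \<in> borel_measurable borel"
  shows "integrable lborel (\<lambda>v. \<phi> (z + v)) \<longleftrightarrow> integrable lborel \<phi>"
    and "(\<integral> v. \<phi> (z + v) \<partial>lborel) = (\<integral> v. \<phi> v \<partial>lborel)"
proof -
  show "integrable lborel (\<lambda>v. \<phi> (z + v)) \<longleftrightarrow> integrable lborel \<phi>"
    by (subst (2) lborel_distr_plus[of z, symmetric]) (subst integrable_distr_eq; simp)
  show "(\<integral> v. \<phi> (z + v) \<partial>lborel) = (\<integral> v. \<phi> v \<partial>lborel)"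
    by (subst (2) lborel_distr_plus[of z, symmetric]) (subst integral_distr; simp)
qed

lemma reproducing_formula:
  fixes G :: "complex ^ 'n \<Rightarrow> complex"
  assumes "entire G" "\<alpha> > 0"
    and int: "integrable lborel (\<lambda>u. exp (of_real \<alpha> * hdot z u) * G u * of_real (exp (- \<alpha> * (norm u)\<^sup>2)))"
  shows "fock_proj \<alpha> G z = G z"
proof -
  note [measurable] = entire_measurable[OF assms(1)]
  define \<phi> where "\<phi> u = exp (of_real \<alpha> * hdot z u) * G u * of_real (exp (- \<alpha> * (norm u)\<^sup>2))" for u
  have [measurable]: "\<phi> \<in> borel_measurable borel"
    unfolding \<phi>_def by measurable
  define F where "F u = G u * exp (of_real (- \<alpha>) * hdot u z + of_real (\<alpha> * (norm z)\<^sup>2))" for u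
  have "entire F"
    unfolding F_def by (intro entire_mult entire_exp entire_add entire_hdot entire_const assms)
  have \<phi>_shift: "\<phi> (z + v) = F (z + v) * of_real (exp (- \<alpha> * (norm v)\<^sup>2))" for v
  proof -
    have *: "of_real ((norm (z + v))\<^sup>2) = of_real ((norm z)\<^sup>2) + hdot z v + hdot v z + of_real ((norm v)\<^sup>2)"
      unfolding hdot_self[symmetric] hdot_add_left hdot_add_right by simp
    have eq: "of_real \<alpha> * hdot z (z + v) + of_real (- \<alpha> * (norm (z + v))\<^sup>2)
      = of_real (- \<alpha>) * hdot (z + v) z + of_real (\<alpha> * (norm z)\<^sup>2) + of_real (- \<alpha> * (norm v)\<^sup>2)"
      unfolding of_real_mult * by (simp add: hdot_add_left hdot_add_right hdot_self algebra_simps)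
    have "\<phi> (z + v) = G (z + v) * exp (of_real \<alpha> * hdot z (z + v) + of_real (- \<alpha> * (norm (z + v))\<^sup>2))"
      by (simp only: \<phi>_def exp_of_real exp_add mult_ac)
    also have "\<dots> = F (z + v) * of_real (exp (- \<alpha> * (norm v)\<^sup>2))"
      unfolding eq by (simp only: F_def exp_of_real exp_add mult_ac)
    finally show ?thesis .
  qed
  have "integrable lborel (\<lambda>v. F (z + v) * of_real (exp (- \<alpha> * (norm v)\<^sup>2)))"
    using int[folded \<phi>_def] lborel_plus(1)[of \<phi> z] by (simp add: \<phi>_shift)
  from entire_gauss_mean[OF \<open>entire F\<close> \<open>\<alpha> > 0\<close> this]
  have "(\<integral> v. \<phi> v \<partial>lborel) = of_real ((pi / \<alpha>) ^ CARD('n)) * F z"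
    using lborel_plus(2)[of \<phi> z] by (simp add: \<phi>_shift)
  moreover have "F z = G z"
    by (simp add: F_def hdot_self)
  moreover have "of_real ((\<alpha> / pi) ^ CARD('n)) * (of_real ((pi / \<alpha>) ^ CARD('n)) :: complex) = 1"
    using \<open>\<alpha> > 0\<close> by (simp add: power_divide)
  ultimately show ?thesis
    by (simp add: fock_proj_def \<phi>_def mult.assoc[symmetric])
qed

subsection \<open>Toeplitz products on kernels\<close>

lemma measurable_cnj [measurable]: "cnj \<in> borel_measurable borel"
  by (intro borel_measurable_continuous_onI continuous_on_cnj continuous_on_id)

lemma integrable_toeplitz_kernel:
  fixes g :: "complex ^ 'n \<Rightarrow> complex"
  assumes "\<alpha> > 0" "p > 1" "1 / p + 1 / q = 1" and g: "g \<in> fock_space \<alpha> q"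
  shows "integrable lborel (\<lambda>u. exp (of_real \<alpha> * hdot w u) * (cnj (g u) * normalized_kernel \<alpha> z u) *
      of_real (exp (- \<alpha> * (norm u)\<^sup>2)))"
proof (rule integrable_fock_pairing[OF assms(2,3) _ g])
  note [measurable] = entire_measurable[OF fock_spaceD(1)[OF g]]
    entire_measurable[OF entire_normalized_kernel]
  let ?k = "\<lambda>u. exp (of_real \<alpha> * hdot u w) * normalized_kernel \<alpha> z u"
  have "norm (?k u) \<le> 1 * exp ((\<alpha> * norm w + \<alpha> * norm z) * norm u)" for u
  proof -
    have "\<alpha> * (u \<bullet> w) \<le> \<alpha> * (norm w * norm u)"
      using assms norm_cauchy_schwarz[of u w] by (intro mult_left_mono) (auto simp: mult.commute)
    then have "norm (exp (of_real \<alpha> * hdot u w)) \<le> exp (\<alpha> * norm w * norm u)"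
      unfolding norm_exp_hdot by (simp add: mult.assoc)
    from mult_mono[OF this norm_normalized_kernel_le[OF \<open>\<alpha> > 0\<close>]] show ?thesis
      by (simp add: norm_mult distrib_right exp_add del: norm_exp_eq_Re)
  qed
  then show "?k \<in> fock_space \<alpha> p"
    using assms by (intro fock_spaceI_growth[where M = 1 and L = "\<alpha> * norm w + \<alpha> * norm z"] entire_mult entire_exp entire_hdot entire_const
        entire_normalized_kernel) auto
  show "(\<lambda>u. exp (of_real \<alpha> * hdot w u) * (cnj (g u) * normalized_kernel \<alpha> z u) *
      of_real (exp (- \<alpha> * (norm u)\<^sup>2))) \<in> borel_measurable borel"
    by measurable
  show "norm (exp (of_real \<alpha> * hdot w u) * (cnj (g u) * normalized_kernel \<alpha> z u) * of_real (exp (- \<alpha> * (norm u)\<^sup>2)))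
    = norm (g u) * norm (?k u) * exp (- \<alpha> * (norm u)\<^sup>2)" for u
    by (simp add: norm_mult norm_exp_hdot inner_commute del: norm_exp_eq_Re)
qed

lemma toeplitz_cnj_kernel:
  fixes g :: "complex ^ 'n \<Rightarrow> complex"
  assumes "\<alpha> > 0" "p > 1" "1 / p + 1 / q = 1" and g: "g \<in> fock_space \<alpha> q"
  shows "toeplitz \<alpha> (\<lambda>u. cnj (g u)) (normalized_kernel \<alpha> z) w = cnj (g z) * normalized_kernel \<alpha> z w"
proof -
  define G where "G u = g u * exp (of_real \<alpha> * hdot u w - of_real (\<alpha> / 2 * (norm z)\<^sup>2))" for u
  define \<phi> where "\<phi> u = exp (of_real \<alpha> * hdot z u) * G u * of_real (exp (- \<alpha> * (norm u)\<^sup>2))" for u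
  have eq: "exp (of_real \<alpha> * hdot w u) * (cnj (g u) * normalized_kernel \<alpha> z u) * of_real (exp (- \<alpha> * (norm u)\<^sup>2))
      = cnj (\<phi> u)" for u
    unfolding \<phi>_def G_def normalized_kernel_def by (simp add: exp_cnj cnj_hdot exp_diff)
  have "integrable lborel \<phi>"
    using integrable_toeplitz_kernel[OF assms, of w z] unfolding eq by simp
  moreover have "entire G"
    unfolding G_def diff_conv_add_uminus using fock_spaceD(1)[OF g]
    by (intro entire_mult entire_exp entire_add entire_hdot entire_const)
  ultimately have "fock_proj \<alpha> G z = G z"
    unfolding \<phi>_def by (intro reproducing_formula \<open>\<alpha> > 0\<close>)
  moreover have "toeplitz \<alpha> (\<lambda>u. cnj (g u)) (normalized_kernel \<alpha> z) w = cnj (fock_proj \<alpha> G z)"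
    unfolding toeplitz_def fock_proj_def eq Bochner_Integration.integral_cnj by (simp add: \<phi>_def[abs_def])
  ultimately show ?thesis
    by (simp add: G_def normalized_kernel_def exp_cnj cnj_hdot)
qed

lemma toeplitz_prod_kernel_sum:
  fixes g :: "complex ^ 'n \<Rightarrow> complex"
  assumes "\<alpha> > 0" "p > 1" "1 / p + 1 / q = 1" and g: "g \<in> fock_space \<alpha> q"
  shows "toeplitz_prod \<alpha> f g (\<lambda>u. \<Sum>z\<in>Z. c z * normalized_kernel \<alpha> z u)
    = (\<lambda>w. \<Sum>z\<in>Z. c z * (f w * cnj (g z) * normalized_kernel \<alpha> z w))"
proof
  fix w
  let ?I = "\<lambda>z u. exp (of_real \<alpha> * hdot w u) * (cnj (g u) * normalized_kernel \<alpha> z u) * of_real (exp (- \<alpha> * (norm u)\<^sup>2))"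
  have "toeplitz \<alpha> (\<lambda>u. cnj (g u)) (\<lambda>u. \<Sum>z\<in>Z. c z * normalized_kernel \<alpha> z u) w
      = of_real ((\<alpha> / pi) ^ CARD('n)) * (\<integral> u. (\<Sum>z\<in>Z. c z * ?I z u) \<partial>lborel)"
    by (simp add: toeplitz_def fock_proj_def sum_distrib_left sum_distrib_right mult_ac)
  also have "(\<integral> u. (\<Sum>z\<in>Z. c z * ?I z u) \<partial>lborel) = (\<Sum>z\<in>Z. \<integral> u. c z * ?I z u \<partial>lborel)"
    by (intro Bochner_Integration.integral_sum integrable_mult_right integrable_toeplitz_kernel[OF assms])
  also have "\<dots> = (\<Sum>z\<in>Z. c z * (\<integral> u. ?I z u \<partial>lborel))"
    by (intro sum.cong integral_mult_right_zero refl)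
  also have "of_real ((\<alpha> / pi) ^ CARD('n)) * \<dots> = (\<Sum>z\<in>Z. c z * toeplitz \<alpha> (\<lambda>u. cnj (g u)) (normalized_kernel \<alpha> z) w)"
    by (simp only: toeplitz_def fock_proj_def sum_distrib_left mult_ac)
  finally show "toeplitz_prod \<alpha> f g (\<lambda>u. \<Sum>z\<in>Z. c z * normalized_kernel \<alpha> z u) w
    = (\<Sum>z\<in>Z. c z * (f w * cnj (g z) * normalized_kernel \<alpha> z w))"
    by (simp add: toeplitz_prod_def toeplitz_cnj_kernel[OF assms] sum_distrib_left mult_ac)
qed

lemma toeplitz_prod_kernel:
  fixes g :: "complex ^ 'n \<Rightarrow> complex"
  assumes "\<alpha> > 0" "p > 1" "1 / p + 1 / q = 1" and g: "g \<in> fock_space \<alpha> q"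
  shows "toeplitz_prod \<alpha> f g (normalized_kernel \<alpha> z) = (\<lambda>w. f w * cnj (g z) * normalized_kernel \<alpha> z w)"
  using toeplitz_cnj_kernel[OF assms] by (simp add: toeplitz_prod_def mult.assoc)

lemma fock_weight_kernel:
  "(norm (f u * normalized_kernel \<alpha> z u) * exp (- (\<alpha> / 2) * (norm u)\<^sup>2)) powr p
    = exp (- (\<alpha> * p / 2) * (norm (z - u))\<^sup>2) * norm (f u) powr p"
proof -
  have "norm (normalized_kernel \<alpha> z u) * exp (- (\<alpha> / 2) * (norm u)\<^sup>2) = exp (- (\<alpha> / 2) * (norm (z - u))\<^sup>2)"
    unfolding norm_normalized_kernel exp_add[symmetric]
    by (simp add: power2_norm_eq_inner inner_diff inner_commute algebra_simps)
  then show ?thesis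
    by (simp add: norm_mult mult.assoc powr_mult exp_powr_real mult_ac)
qed

lemma fock_norm_powr:
  fixes f :: "complex ^ 'n \<Rightarrow> complex"
  assumes "\<alpha> > 0" "p > 0"
  shows "fock_norm \<alpha> p f powr p = (p * \<alpha> / (2 * pi)) ^ CARD('n) *
      (LINT z|lborel. (norm (f z) * exp (- (\<alpha> / 2) * (norm z)\<^sup>2)) powr p)"
proof -
  have "0 \<le> (LINT z|lborel. (norm (f z) * exp (- (\<alpha> / 2) * (norm z)\<^sup>2)) powr p)"
    by (intro Bochner_Integration.integral_nonneg) simp
  then show ?thesis
    using assms by (simp add: fock_norm_def powr_powr)
qed

lemma fock_norm_nonneg [simp]: "fock_norm \<alpha> p f \<ge> 0"
  by (simp add: fock_norm_def)

lemma heat_transform_eq_fock_norm: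
  fixes f :: "complex ^ 'n \<Rightarrow> complex"
  assumes "\<alpha> > 0" "p > 0" and mem: "(\<lambda>u. f u * normalized_kernel \<alpha> z u) \<in> fock_space \<alpha> p"
  shows "heat_transform (\<alpha> * p / 2) (\<lambda>u. norm (f u) powr p) z
    = ennreal (fock_norm \<alpha> p (\<lambda>u. f u * normalized_kernel \<alpha> z u) powr p)"
proof -
  let ?I = "\<lambda>u. exp (- (\<alpha> * p / 2) * (norm (z - u))\<^sup>2) * norm (f u) powr p"
  have "integrable lborel ?I"
    using fock_spaceD(2)[OF mem] unfolding fock_weight_kernel .
  then have "(\<integral>\<^sup>+ u. ennreal (?I u) \<partial>lborel) = ennreal (\<integral> u. ?I u \<partial>lborel)"
    by (intro nn_integral_eq_integral) auto
  moreover have "0 \<le> (\<integral> u. ?I u \<partial>lborel)"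
    by (intro Bochner_Integration.integral_nonneg) simp
  moreover have scale: "(\<alpha> * p / 2 / pi) ^ CARD('n) = (p * \<alpha> / (2 * pi)) ^ CARD('n)"
    by (simp add: mult.commute)
  ultimately show ?thesis
    using assms unfolding heat_transform_def fock_norm_powr[OF assms(1,2)] fock_weight_kernel scale
    by (simp add: ennreal_mult)
qed

lemma heat_transform_exp:
  fixes \<beta> :: "complex ^ 'n"
  assumes "\<alpha> > 0" "p > 0" and f: "\<And>u. f u = a * exp (of_real \<alpha> * hdot u \<beta>)"
  shows "heat_transform (\<alpha> * p / 2) (\<lambda>u. norm (f u) powr p) z
    = ennreal ((norm (f z) * exp (\<alpha> / 2 * (norm \<beta>)\<^sup>2)) powr p)"
proof -
  define K where "K = (norm (f z) * exp (\<alpha> / 2 * (norm \<beta>)\<^sup>2)) powr p"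
  define b where "b = \<alpha> * p / 2"
  have "b > 0" using assms by (simp add: b_def)
  have [measurable]: "f \<in> borel_measurable borel"
    unfolding f by measurable
  have eq: "exp (- b * (norm v)\<^sup>2) * norm (f (z + v)) powr p = K * exp (- b * (norm (- \<beta> + v))\<^sup>2)" for v
  proof -
    have "norm (f (z + v)) = norm (f z) * exp (\<alpha> * (v \<bullet> \<beta>))"
      unfolding f by (simp add: norm_mult Re_hdot inner_add_left distrib_left exp_add)
    then have "exp (- b * (norm v)\<^sup>2) * norm (f (z + v)) powr p = norm (f z) powr p * exp (- b * (norm v)\<^sup>2 + \<alpha> * p * (v \<bullet> \<beta>))"
      unfolding exp_add by (simp add: powr_mult exp_powr_real mult_ac)
    also have "- b * (norm v)\<^sup>2 + \<alpha> * p * (v \<bullet> \<beta>) = \<alpha> * p / 2 * (norm \<beta>)\<^sup>2 + - b * (norm (- \<beta> + v))\<^sup>2"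
      unfolding power2_norm_eq_inner b_def
      by (simp add: inner_diff inner_add inner_commute[of \<beta> v] algebra_simps)
    finally show ?thesis
      unfolding exp_add by (simp add: K_def powr_mult exp_powr_real mult_ac)
  qed
  have "heat_transform b (\<lambda>u. norm (f u) powr p) z
      = ennreal ((b / pi) ^ CARD('n)) * (\<integral>\<^sup>+ v. ennreal K * ennreal (exp (- b * (norm (- \<beta> + v))\<^sup>2)) \<partial>lborel)"
    by (subst heat_transform_shift, measurable) (simp only: eq ennreal_mult K_def powr_ge_zero exp_ge_zero)
  also have "\<dots> = ennreal ((b / pi) ^ CARD('n)) * (ennreal K * ennreal ((pi / b) ^ CARD('n)))"
    using nn_integral_lborel_plus[of "\<lambda>v. ennreal (exp (- b * (norm v)\<^sup>2))" "- \<beta>"] nn_integral_gauss[OF \<open>b > 0\<close>, where 'n = 'n]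
    by (subst nn_integral_cmult) auto
  also have "\<dots> = ennreal K"
    using \<open>b > 0\<close> by (simp add: power_divide K_def flip: ennreal_mult)
  finally show ?thesis
    by (simp add: b_def K_def)
qed

subsection \<open>Rigidity of the bounded heat product\<close>

definition heat_product_bounded ::
  "real \<Rightarrow> real \<Rightarrow> (complex ^ 'n \<Rightarrow> complex) \<Rightarrow> (complex ^ 'n \<Rightarrow> complex) \<Rightarrow> bool" where
  "heat_product_bounded \<alpha> p f g \<longleftrightarrow>
     (\<exists>C. \<forall>z. heat_transform (\<alpha> * p / 2) (\<lambda>u. norm (f u) powr p) z * ennreal (norm (g z) powr p)
        \<le> ennreal C)"

lemma powr_left_cancel:
  fixes x y p :: real
  assumes "x powr p = y powr p" "x \<ge> 0" "y \<ge> 0" "p > 0"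
  shows "x = y"
  using arg_cong[OF assms(1), of "\<lambda>t. t powr (1 / p)"] assms(2-) by (simp add: powr_powr)

lemma fock_norm_cmult:
  fixes h :: "complex ^ 'n \<Rightarrow> complex"
  assumes "\<alpha> > 0" "p > 0"
  shows "fock_norm \<alpha> p (\<lambda>u. c * h u) = norm c * fock_norm \<alpha> p h"
proof -
  have "fock_norm \<alpha> p (\<lambda>u. c * h u) powr p = norm c powr p * fock_norm \<alpha> p h powr p"
    unfolding fock_norm_powr[OF assms] by (simp add: norm_mult powr_mult mult.assoc)
  also have "\<dots> = (norm c * fock_norm \<alpha> p h) powr p"
    by (simp add: powr_mult)
  finally show ?thesis
    by (rule powr_left_cancel) (use assms in auto)
qed

lemma fock_space_cmult:
  assumes "h \<in> fock_space \<alpha> p"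
  shows "(\<lambda>u. c * h u) \<in> fock_space \<alpha> p"
  using assms unfolding fock_space_def
  by (auto simp: norm_mult powr_mult mult.assoc intro!: entire_mult)

lemma fock_norm_kernel:
  fixes z :: "complex ^ 'n"
  assumes "\<alpha> > 0" "p > 0"
  shows "fock_norm \<alpha> p (normalized_kernel \<alpha> z) = 1"
proof -
  have "(\<lambda>u. 1 * normalized_kernel \<alpha> z u) \<in> fock_space \<alpha> p"
    using kernel_span_subset_fock[OF assms] normalized_kernel_in_span by fastforce
  from heat_transform_eq_fock_norm[OF assms this]
    heat_transform_exp[of \<alpha> p "\<lambda>_. 1" 1 "0 :: complex ^ 'n" z]
  have "ennreal (fock_norm \<alpha> p (normalized_kernel \<alpha> z) powr p) = ennreal 1"
    using assms by (simp add: hdot_def)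
  then have "fock_norm \<alpha> p (normalized_kernel \<alpha> z) powr p = 1 powr p"
    by (subst (asm) ennreal_inj) auto
  then show ?thesis
    by (rule powr_left_cancel) (use assms in auto)
qed

lemma toeplitz_prod_bounded_imp_heat_product_bounded:
  fixes f g :: "complex ^ 'n \<Rightarrow> complex"
  assumes "\<alpha> > 0" "p > 1" "1 / p + 1 / q = 1" "g \<in> fock_space \<alpha> q"
    and "toeplitz_prod_bounded \<alpha> p f g"
  shows "heat_product_bounded \<alpha> p f g"
proof -
  have "p > 0" using assms by simp
  note span_fock = kernel_span_subset_fock[OF \<open>\<alpha> > 0\<close> \<open>p > 0\<close>]
  obtain S C where S: "\<And>h. h \<in> kernel_span \<alpha> \<Longrightarrow> S h = toeplitz_prod \<alpha> f g h"
    and C: "\<And>h. h \<in> fock_space \<alpha> p \<Longrightarrow> fock_norm \<alpha> p (S h) \<le> C * fock_norm \<alpha> p h"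
    and S_mem: "\<And>h. h \<in> fock_space \<alpha> p \<Longrightarrow> S h \<in> fock_space \<alpha> p"
    using assms(5) unfolding toeplitz_prod_bounded_def toeplitz_prod_extension_def
      bounded_fock_operator_def by metis
  have "heat_transform (\<alpha> * p / 2) (\<lambda>u. norm (f u) powr p) z * ennreal (norm (g z) powr p)
      \<le> ennreal (C powr p)" for z
  proof (cases "g z = 0")
    case False
    let ?k = "normalized_kernel \<alpha> z" and ?fk = "\<lambda>u. f u * normalized_kernel \<alpha> z u"
    have k: "?k \<in> kernel_span \<alpha>" "?k \<in> fock_space \<alpha> p"
      using normalized_kernel_in_span span_fock by auto
    have Sk: "S ?k = (\<lambda>w. cnj (g z) * ?fk w)"
      using S[OF k(1)] toeplitz_prod_kernel[OF assms(1-4)] by (simp add: mult_ac)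
    have "(\<lambda>w. inverse (cnj (g z)) * (cnj (g z) * ?fk w)) \<in> fock_space \<alpha> p"
      using S_mem[OF k(2)] unfolding Sk by (rule fock_space_cmult)
    moreover have "(\<lambda>w. inverse (cnj (g z)) * (cnj (g z) * ?fk w)) = ?fk"
      using False by (simp add: fun_eq_iff)
    ultimately have fk: "?fk \<in> fock_space \<alpha> p" by simp
    have "norm (g z) * fock_norm \<alpha> p ?fk \<le> C"
      using C[OF k(2)] assms unfolding Sk by (simp add: fock_norm_cmult fock_norm_kernel)
    then have "(norm (g z) * fock_norm \<alpha> p ?fk) powr p \<le> C powr p"
      using \<open>p > 0\<close> by (intro powr_mono2) auto
    then show ?thesis
      unfolding heat_transform_eq_fock_norm[OF \<open>\<alpha> > 0\<close> \<open>p > 0\<close> fk]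
      by (auto simp: powr_mult mult.commute simp flip: ennreal_mult intro!: ennreal_leI)
  qed simp
  then show ?thesis
    unfolding heat_product_bounded_def by blast
qed

lemma ennreal_pow_mono:
  assumes "x \<le> y" "r > 0"
  shows "ennreal_pow x r \<le> ennreal_pow y r"
proof (cases "y = \<infinity>")
  case False
  then have "y < top" by (simp add: less_top)
  then have "enn2real x \<le> enn2real y" "x \<noteq> \<infinity>"
    using assms by (auto intro: enn2real_mono)
  then show ?thesis
    using assms False by (auto simp: ennreal_pow_def intro!: ennreal_leI powr_mono2)
qed (simp add: ennreal_pow_def)

lemma ennreal_pow_powr:
  assumes "x \<ge> 0" "r > 0"
  shows "ennreal_pow (ennreal (x powr r)) (1 / r) = ennreal x"
  using assms by (simp add: ennreal_pow_def powr_powr)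

lemma ennreal_pow_mult_le_imp:
  assumes "ennreal_pow x (1 / p) * ennreal b \<le> ennreal K" "p > 0" "b \<ge> 0" "K \<ge> 0"
  shows "x * ennreal (b powr p) \<le> ennreal (K powr p)"
proof (cases "x = \<infinity>")
  case True
  then have "b = 0"
    using assms by (auto simp: ennreal_pow_def ennreal_top_mult top_unique split: if_splits)
  then show ?thesis by simp
next
  case False
  then obtain r where r: "x = ennreal r" "r \<ge> 0"
    by (cases x) auto
  then have "ennreal (r powr (1 / p) * b) \<le> ennreal K"
    using assms by (simp add: ennreal_pow_def ennreal_mult)
  then have "r powr (1 / p) * b \<le> K"
    using assms by simp
  then have "(r powr (1 / p) * b) powr p \<le> K powr p"
    using assms r by (intro powr_mono2) auto
  then show ?thesis
    using r assms by (auto simp: powr_mult powr_powr simp flip: ennreal_mult intro!: ennreal_leI)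
qed

lemma SUP_heat_product_imp_bounded:
  fixes f g :: "complex ^ 'n \<Rightarrow> complex"
  assumes "\<alpha> > 0" "p > 1" "q > 1" "entire g"
    and B: "(SUP z. ennreal_pow (heat_transform (\<alpha> * p / 2) (\<lambda>u. norm (f u) powr p) z) (1 / p) *
           ennreal_pow (heat_transform (\<alpha> * q / 2) (\<lambda>u. norm (g u) powr q) z) (1 / q)) < \<infinity>"
  shows "heat_product_bounded \<alpha> p f g"
proof -
  let ?Hf = "\<lambda>z. ennreal_pow (heat_transform (\<alpha> * p / 2) (\<lambda>u. norm (f u) powr p) z) (1 / p)"
  let ?Hg = "\<lambda>z. ennreal_pow (heat_transform (\<alpha> * q / 2) (\<lambda>u. norm (g u) powr q) z) (1 / q)"
  obtain K where K: "(SUP z. ?Hf z * ?Hg z) = ennreal K" "K \<ge> 0"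
    using B by (cases "(SUP z. ?Hf z * ?Hg z)") auto
  have "heat_transform (\<alpha> * p / 2) (\<lambda>u. norm (f u) powr p) z * ennreal (norm (g z) powr p) \<le> ennreal (K powr p)" for z
  proof (rule ennreal_pow_mult_le_imp)
    have "ennreal (norm (g z)) = ennreal_pow (ennreal (norm (g z) powr q)) (1 / q)"
      using assms by (intro ennreal_pow_powr[symmetric]) auto
    also have "\<dots> \<le> ?Hg z"
      using assms by (intro ennreal_pow_mono heat_transform_ge) auto
    finally have "?Hf z * ennreal (norm (g z)) \<le> ?Hf z * ?Hg z"
      by (intro mult_left_mono) auto
    also have "\<dots> \<le> (SUP z. ?Hf z * ?Hg z)"
      by (rule SUP_upper) simp
    finally show "?Hf z * ennreal (norm (g z)) \<le> ennreal K"
      unfolding K(1) .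
  qed (use assms K in auto)
  then show ?thesis
    unfolding heat_product_bounded_def by blast
qed

lemma entire_bounded_constant:
  assumes "entire F" "\<And>z. norm (F z) \<le> C"
  shows "F z = F 0"
proof -
  have "(\<lambda>t. F (0 + t *s z)) constant_on UNIV"
    using assms by (intro Liouville_theorem entire_holomorphic_line boundedI[of _ C]) auto
  then obtain c where "\<And>t. F (0 + t *s z) = c"
    unfolding constant_on_def by auto
  from this[of 0] this[of 1] show ?thesis by simp
qed

lemma heat_product_bounded_imp_product:
  fixes f g :: "complex ^ 'n \<Rightarrow> complex"
  assumes "\<alpha> > 0" "p > 1" "entire f" "entire g" "heat_product_bounded \<alpha> p f g"
  shows "f (z + w) * g z = f w * g 0"
proof -
  obtain C where C: "\<And>z. heat_transform (\<alpha> * p / 2) (\<lambda>u. norm (f u) powr p) z * ennreal (norm (g z) powr p) \<le> ennreal C"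
    using assms(5) unfolding heat_product_bounded_def by auto
  define c where "c = 2 ^ CARD('n) * exp (2 * (\<alpha> * p / 2) * (norm w)\<^sup>2)"
  have "c \<ge> 0" by (simp add: c_def)
  have "norm (f (z + w) * g z) \<le> (c * max C 0) powr (1 / p)" for z
  proof -
    have "ennreal (norm (f (z + w) * g z) powr p) = ennreal (norm (f (z + w)) powr p) * ennreal (norm (g z) powr p)"
      by (simp add: norm_mult powr_mult ennreal_mult)
    also have "\<dots> \<le> ennreal c * heat_transform (\<alpha> * p / 2) (\<lambda>u. norm (f u) powr p) z * ennreal (norm (g z) powr p)"
      unfolding c_def using assms by (intro mult_right_mono heat_transform_ge_shift) auto
    also have "\<dots> \<le> ennreal c * ennreal (max C 0)"
      unfolding mult.assoc by (intro mult_left_mono order_trans[OF C[of z]] ennreal_leI) auto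
    finally have "norm (f (z + w) * g z) powr p \<le> c * max C 0"
      using \<open>c \<ge> 0\<close> by (simp flip: ennreal_mult)
    then have "(norm (f (z + w) * g z) powr p) powr (1 / p) \<le> (c * max C 0) powr (1 / p)"
      using assms by (intro powr_mono2) auto
    then show ?thesis
      using assms by (simp add: powr_powr)
  qed
  then have "f (z + w) * g z = f (0 + w) * g 0"
    using assms by (intro entire_bounded_constant[where F = "\<lambda>z. f (z + w) * g z"] entire_mult entire_shift)
  then show ?thesis by simp
qed

lemma entire_multiplicative_imp_exp:
  fixes f :: "complex ^ 'n \<Rightarrow> complex"
  assumes "entire f" "\<alpha> > 0" "f 0 \<noteq> 0" and mult: "\<And>z w. f (z + w) * f 0 = f z * f w"
  shows "\<exists>\<beta>. \<forall>u. f u = f 0 * exp (of_real \<alpha> * hdot u \<beta>)"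
proof -
  obtain D where D: "(f has_derivative D) (at 0)" and lin: "\<And>c v. D (c *s v) = c * D v"
    using assms unfolding entire_def by blast
  have "linear D"
    using D has_derivative_linear by blast
  define \<beta> :: "complex ^ 'n" where "\<beta> = (\<chi> j. cnj (D (axis j 1) / (of_real \<alpha> * f 0)))"
  have D_eq: "D v = f 0 * (of_real \<alpha> * hdot v \<beta>)" for v
  proof -
    have "v = (\<Sum>j\<in>UNIV. v $ j *s axis j 1)"
      by (simp add: basis_expansion)
    then have "D v = D (\<Sum>j\<in>UNIV. v $ j *s axis j 1)" by simp
    also have "\<dots> = (\<Sum>j\<in>UNIV. v $ j * D (axis j 1))"
      using \<open>linear D\<close> by (simp add: linear_sum lin)
    also have "\<dots> = f 0 * (of_real \<alpha> * hdot v \<beta>)"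
      using assms by (simp add: hdot_def \<beta>_def sum_distrib_left)
    finally show ?thesis .
  qed
  have "f u = f 0 * exp (of_real \<alpha> * hdot u \<beta>)" for u
  proof -
    define d where "d = of_real \<alpha> * hdot u \<beta>"
    define \<psi> where "\<psi> t = f (0 + t *s u)" for t :: complex
    have \<psi>0: "(\<psi> has_field_derivative f 0 * d) (at 0)"
      using entire_line_has_field_derivative[of f D 0 0 u] D lin D_eq unfolding \<psi>_def d_def by simp
    have \<psi>_mult: "\<psi> (t + s) = \<psi> t * \<psi> s / f 0" for t s
      using mult[of "t *s u" "s *s u"] \<open>f 0 \<noteq> 0\<close> by (simp add: \<psi>_def field_simps vector_sadd_rdistrib)
    have \<psi>': "(\<psi> has_field_derivative \<psi> t * d) (at t)" for t
    proof -
      have "((\<lambda>s. \<psi> t * \<psi> s / f 0) has_field_derivative \<psi> t * (f 0 * d) / f 0) (at 0)"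
        by (intro DERIV_cdivide DERIV_cmult \<psi>0)
      then have "((\<lambda>s. \<psi> (t + s)) has_field_derivative \<psi> t * d) (at 0)"
        using \<open>f 0 \<noteq> 0\<close> by (simp add: \<psi>_mult)
      then show ?thesis
        using DERIV_shift[of \<psi> "\<psi> t * d" 0 t] by (simp add: add.commute)
    qed
    have "((\<lambda>t. \<psi> t * exp (- d * t)) has_field_derivative 0) (at t within UNIV)" for t
      by (auto intro!: derivative_eq_intros \<psi>')
    then have "\<exists>c. \<forall>t\<in>UNIV. \<psi> t * exp (- d * t) = c"
      by (intro has_field_derivative_zero_constant) auto
    then obtain c where "\<And>t. \<psi> t * exp (- d * t) = c"
      by auto
    from this[of 0] this[of 1] have "f u * exp (- d) = f 0"
      by (simp add: \<psi>_def)
    then show ?thesis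
      by (simp add: d_def exp_minus field_simps)
  qed
  then show ?thesis by blast
qed

lemma heat_product_bounded_cases:
  fixes f g :: "complex ^ 'n \<Rightarrow> complex"
  assumes "\<alpha> > 0" "p > 1" "entire f" "entire g" "heat_product_bounded \<alpha> p f g"
  obtains (f_zero) "f = (\<lambda>_. 0)" | (g_zero) "g = (\<lambda>_. 0)"
  | (exp) a c \<beta> where "a \<noteq> 0" "c \<noteq> 0" "f = (\<lambda>u. a * exp (of_real \<alpha> * hdot u \<beta>))"
      "g = (\<lambda>u. c * exp (of_real \<alpha> * hdot u (- \<beta>)))"
proof -
  note prod = heat_product_bounded_imp_product[OF assms]
  have fg: "f z * g z = f 0 * g 0" for z
    using prod[of z 0] by simp
  show thesis
  proof (cases "f 0 = 0 \<or> g 0 = 0")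
    case True
    show thesis
    proof (cases "\<exists>z. g z \<noteq> 0")
      case True
      then obtain z where "g z \<noteq> 0" by blast
      have "f u = 0" for u
      proof (cases "g 0 = 0")
        case True
        then show ?thesis
          using prod[of z "u - z"] \<open>g z \<noteq> 0\<close> by simp
      next
        case False
        then show ?thesis
          using prod[of "- u" u] \<open>f 0 = 0 \<or> g 0 = 0\<close> by simp
      qed
      then show thesis using f_zero by blast
    next
      case False
      then show thesis using g_zero by blast
    qed
  next
    case False
    then have "f z \<noteq> 0" for z
      using fg[of z] by auto
    have "f (z + w) * f 0 = f z * f w" for z w
    proof -
      have "g z \<noteq> 0" using False fg[of z] by auto
      have "f (z + w) * f 0 * g 0 * g z = f w * g 0 * f 0 * g 0"
        using prod[of z w] by (simp add: mult_ac)
      also have "\<dots> = f z * f w * g 0 * g z"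
        using fg[of z] by (simp add: mult_ac)
      finally show ?thesis using False \<open>g z \<noteq> 0\<close> by simp
    qed
    then obtain \<beta> where \<beta>: "\<And>u. f u = f 0 * exp (of_real \<alpha> * hdot u \<beta>)"
      using entire_multiplicative_imp_exp[OF \<open>entire f\<close> \<open>\<alpha> > 0\<close>] False by metis
    have g_eq: "g u = g 0 * exp (of_real \<alpha> * hdot u (- \<beta>))" for u
      using fg[of u] \<beta>[of u] False by (simp add: hdot_uminus_right exp_minus field_simps)
    have "f 0 \<noteq> 0" "g 0 \<noteq> 0"
      using False by auto
    then show thesis
      by (rule exp) (rule ext, rule \<beta>, rule ext, rule g_eq)
  qed
qed

subsection \<open>Weyl translations\<close>

definition weyl_translation ::
  "real \<Rightarrow> complex \<Rightarrow> complex ^ 'n \<Rightarrow> (complex ^ 'n \<Rightarrow> complex) \<Rightarrow> complex ^ 'n \<Rightarrow> complex" where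
  "weyl_translation \<alpha> \<gamma> \<beta> h = (\<lambda>u. \<gamma> * exp (of_real \<alpha> * hdot u \<beta>) * h (u - \<beta>))"

lemma weyl_translation_weight:
  "(norm (weyl_translation \<alpha> \<gamma> \<beta> h u) * exp (- (\<alpha> / 2) * (norm u)\<^sup>2)) powr p
    = (norm \<gamma> * exp (\<alpha> / 2 * (norm \<beta>)\<^sup>2)) powr p *
      (norm (h (- \<beta> + u)) * exp (- (\<alpha> / 2) * (norm (- \<beta> + u))\<^sup>2)) powr p"
proof -
  have "\<alpha> * (u \<bullet> \<beta>) + - (\<alpha> / 2) * (norm u)\<^sup>2 = \<alpha> / 2 * (norm \<beta>)\<^sup>2 + - (\<alpha> / 2) * (norm (- \<beta> + u))\<^sup>2"
    unfolding power2_norm_eq_inner by (simp add: inner_diff inner_add inner_commute[of \<beta> u] algebra_simps)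
  then have "exp (\<alpha> * (u \<bullet> \<beta>)) * exp (- (\<alpha> / 2) * (norm u)\<^sup>2)
      = exp (\<alpha> / 2 * (norm \<beta>)\<^sup>2) * exp (- (\<alpha> / 2) * (norm (- \<beta> + u))\<^sup>2)"
    unfolding exp_add[symmetric] by simp
  then have "norm (weyl_translation \<alpha> \<gamma> \<beta> h u) * exp (- (\<alpha> / 2) * (norm u)\<^sup>2)
      = (norm \<gamma> * exp (\<alpha> / 2 * (norm \<beta>)\<^sup>2)) * (norm (h (- \<beta> + u)) * exp (- (\<alpha> / 2) * (norm (- \<beta> + u))\<^sup>2))"
    unfolding weyl_translation_def norm_mult norm_exp_hdot by (simp add: mult_ac)
  then show ?thesis
    by (simp only: powr_mult)
qed

lemma weyl_translation_fock:
  fixes h :: "complex ^ 'n \<Rightarrow> complex"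
  assumes h: "h \<in> fock_space \<alpha> p"
  shows "weyl_translation \<alpha> \<gamma> \<beta> h \<in> fock_space \<alpha> p"
    and "\<alpha> > 0 \<Longrightarrow> p > 0 \<Longrightarrow>
      fock_norm \<alpha> p (weyl_translation \<alpha> \<gamma> \<beta> h) = norm \<gamma> * exp (\<alpha> / 2 * (norm \<beta>)\<^sup>2) * fock_norm \<alpha> p h"
proof -
  note [measurable] = entire_measurable[OF fock_spaceD(1)[OF h]]
  let ?w = "\<lambda>u. (norm (h u) * exp (- (\<alpha> / 2) * (norm u)\<^sup>2)) powr p"
  have w: "?w \<in> borel_measurable borel"
    by measurable
  have "entire (weyl_translation \<alpha> \<gamma> \<beta> h)"
    unfolding weyl_translation_def diff_conv_add_uminus
    by (intro entire_mult entire_const entire_exp entire_hdot entire_shift fock_spaceD(1)[OF h])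
  moreover have "integrable lborel (\<lambda>u. (norm (weyl_translation \<alpha> \<gamma> \<beta> h u) * exp (- (\<alpha> / 2) * (norm u)\<^sup>2)) powr p)"
    unfolding weyl_translation_weight
    by (intro integrable_mult_right iffD2[OF lborel_plus(1)[OF w, of "- \<beta>"]] fock_spaceD(2)[OF h])
  ultimately show "weyl_translation \<alpha> \<gamma> \<beta> h \<in> fock_space \<alpha> p"
    by (simp add: fock_space_def)
  show "fock_norm \<alpha> p (weyl_translation \<alpha> \<gamma> \<beta> h) = norm \<gamma> * exp (\<alpha> / 2 * (norm \<beta>)\<^sup>2) * fock_norm \<alpha> p h"
    if "\<alpha> > 0" "p > 0"
  proof (rule powr_left_cancel)
    show "fock_norm \<alpha> p (weyl_translation \<alpha> \<gamma> \<beta> h) powr p = (norm \<gamma> * exp (\<alpha> / 2 * (norm \<beta>)\<^sup>2) * fock_norm \<alpha> p h) powr p"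
      unfolding powr_mult[of _ "fock_norm \<alpha> p h"] fock_norm_powr[OF that] weyl_translation_weight
        integral_mult_right_zero lborel_plus(2)[OF w, of "- \<beta>"]
      by (simp add: mult_ac)
  qed (use that in auto)
qed

lemma bounded_fock_operator_weyl:
  fixes \<beta> :: "complex ^ 'n"
  assumes "\<alpha> > 0" "p > 0"
  shows "bounded_fock_operator \<alpha> p (weyl_translation \<alpha> \<gamma> \<beta>)"
  unfolding bounded_fock_operator_def
proof (intro conjI ballI allI exI)
  fix h :: "complex ^ 'n \<Rightarrow> complex" assume "h \<in> fock_space \<alpha> p"
  then show "weyl_translation \<alpha> \<gamma> \<beta> h \<in> fock_space \<alpha> p"
    by (rule weyl_translation_fock)
  show "fock_norm \<alpha> p (weyl_translation \<alpha> \<gamma> \<beta> h) \<le> norm \<gamma> * exp (\<alpha> / 2 * (norm \<beta>)\<^sup>2) * fock_norm \<alpha> p h"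
    using weyl_translation_fock(2)[OF \<open>h \<in> fock_space \<alpha> p\<close> assms] by simp
qed (simp add: weyl_translation_def algebra_simps fun_eq_iff)

lemma weyl_translation_inverse:
  assumes "\<gamma> \<noteq> 0" and \<delta>: "\<delta> = inverse \<gamma> * exp (- of_real \<alpha> * hdot \<beta> \<beta>)"
  shows "weyl_translation \<alpha> \<delta> (- \<beta>) (weyl_translation \<alpha> \<gamma> \<beta> h) = h"
    and "weyl_translation \<alpha> \<gamma> \<beta> (weyl_translation \<alpha> \<delta> (- \<beta>) h) = h"
  using \<open>\<gamma> \<noteq> 0\<close>
  by (simp_all add: weyl_translation_def \<delta> fun_eq_iff hdot_uminus_right hdot_add_left hdot_diff_left
      exp_minus exp_add exp_diff algebra_simps)

lemma toeplitz_prod_exp: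
  fixes \<beta> :: "complex ^ 'n"
  assumes "\<alpha> > 0" "p > 1" "1 / p + 1 / q = 1" "g \<in> fock_space \<alpha> q"
    and f: "f = (\<lambda>u. a * exp (of_real \<alpha> * hdot u \<beta>))"
    and g: "g = (\<lambda>u. c * exp (of_real \<alpha> * hdot u (- \<beta>)))"
    and "h \<in> kernel_span \<alpha>"
  shows "weyl_translation \<alpha> (a * cnj c) \<beta> h = toeplitz_prod \<alpha> f g h"
proof -
  obtain Z d where h: "h = (\<lambda>u. \<Sum>z\<in>Z. d z * normalized_kernel \<alpha> z u)"
    using \<open>h \<in> kernel_span \<alpha>\<close> by (auto simp: kernel_span_def)
  have "a * cnj c * exp (of_real \<alpha> * hdot u \<beta>) * normalized_kernel \<alpha> z (u - \<beta>)
      = f u * cnj (g z) * normalized_kernel \<alpha> z u" for u z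
  proof -
    have "normalized_kernel \<alpha> z (u - \<beta>) = exp (- (of_real \<alpha> * hdot \<beta> z)) * normalized_kernel \<alpha> z u"
      unfolding normalized_kernel_def exp_add[symmetric] by (simp add: hdot_diff_left algebra_simps)
    then show ?thesis
      by (simp add: f g hdot_uminus_right exp_cnj cnj_hdot mult_ac)
  qed
  then show ?thesis
    unfolding h toeplitz_prod_kernel_sum[OF assms(1-4)]
    by (simp add: weyl_translation_def sum_distrib_left fun_eq_iff mult.left_commute)
qed

lemma toeplitz_prod_exp_invertible:
  fixes \<beta> :: "complex ^ 'n"
  assumes "\<alpha> > 0" "p > 1" "1 / p + 1 / q = 1" "g \<in> fock_space \<alpha> q"
    and "a \<noteq> 0" "c \<noteq> 0"
    and f: "f = (\<lambda>u. a * exp (of_real \<alpha> * hdot u \<beta>))"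
    and g: "g = (\<lambda>u. c * exp (of_real \<alpha> * hdot u (- \<beta>)))"
  shows "toeplitz_prod_invertible \<alpha> p f g"
proof -
  let ?S = "weyl_translation \<alpha> (a * cnj c) \<beta>"
  let ?R = "weyl_translation \<alpha> (inverse (a * cnj c) * exp (- of_real \<alpha> * hdot \<beta> \<beta>)) (- \<beta>)"
  have "p > 0" using assms by simp
  note toeplitz_eq = toeplitz_prod_exp[OF assms(1-4) f g]
  have ext: "toeplitz_prod_extension \<alpha> p f g ?S"
    unfolding toeplitz_prod_extension_def
    using bounded_fock_operator_weyl[OF \<open>\<alpha> > 0\<close> \<open>p > 0\<close>] toeplitz_eq by blast
  have "toeplitz_prod \<alpha> f g h \<in> fock_space \<alpha> p" if "h \<in> kernel_span \<alpha>" for h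
    unfolding toeplitz_eq[OF that, symmetric]
    using that kernel_span_subset_fock[OF \<open>\<alpha> > 0\<close> \<open>p > 0\<close>] by (intro weyl_translation_fock) auto
  then have "toeplitz_prod_bounded \<alpha> p f g"
    unfolding toeplitz_prod_bounded_def using ext by blast
  moreover have "?R (?S h) = h" "?S (?R h) = h" for h
    using assms by (intro weyl_translation_inverse; simp)+
  ultimately show ?thesis
    unfolding toeplitz_prod_invertible_def
    using ext bounded_fock_operator_weyl[OF \<open>\<alpha> > 0\<close> \<open>p > 0\<close>] by blast
qed

lemma toeplitz_prod_bounded_zero:
  fixes f g :: "complex ^ 'n \<Rightarrow> complex"
  assumes "f = (\<lambda>_. 0) \<or> g = (\<lambda>_. 0)" "p > 0"
  shows "toeplitz_prod_bounded \<alpha> p f g"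
proof -
  have zero: "(\<lambda>_. 0 :: complex) \<in> fock_space \<alpha> p" "fock_norm \<alpha> p (\<lambda>_ :: complex ^ 'n. 0) = 0"
    by (simp_all add: fock_space_def fock_norm_def)
  have prod: "toeplitz_prod \<alpha> f g h = (\<lambda>_. 0)" for h
    using assms by (auto simp: toeplitz_prod_def toeplitz_def fock_proj_def)
  have "toeplitz_prod_extension \<alpha> p f g (\<lambda>_ _. 0)"
    unfolding toeplitz_prod_extension_def bounded_fock_operator_def prod
    using zero by (auto intro: exI[of _ 0])
  then show ?thesis
    unfolding toeplitz_prod_bounded_def prod using zero by blast
qed

lemma heat_transform_zero: "p > 0 \<Longrightarrow> heat_transform \<beta> (\<lambda>u. norm (0 :: complex) powr p) z = 0"
  by (simp add: heat_transform_def)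

lemma SUP_heat_product_zero:
  fixes f g :: "complex ^ 'n \<Rightarrow> complex"
  assumes "f = (\<lambda>_. 0) \<or> g = (\<lambda>_. 0)" "p > 0" "q > 0"
  shows "(SUP z. ennreal_pow (heat_transform (\<alpha> * p / 2) (\<lambda>u. norm (f u) powr p) z) (1 / p) *
           ennreal_pow (heat_transform (\<alpha> * q / 2) (\<lambda>u. norm (g u) powr q) z) (1 / q)) < \<infinity>"
  using assms by (auto simp: heat_transform_zero ennreal_pow_def simp del: norm_zero)

lemma SUP_heat_product_exp:
  fixes \<beta> :: "complex ^ 'n"
  assumes "\<alpha> > 0" "p > 0" "q > 0"
    and f: "f = (\<lambda>u. a * exp (of_real \<alpha> * hdot u \<beta>))"
    and g: "g = (\<lambda>u. c * exp (of_real \<alpha> * hdot u (- \<beta>)))"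
  shows "(SUP z. ennreal_pow (heat_transform (\<alpha> * p / 2) (\<lambda>u. norm (f u) powr p) z) (1 / p) *
           ennreal_pow (heat_transform (\<alpha> * q / 2) (\<lambda>u. norm (g u) powr q) z) (1 / q)) < \<infinity>"
proof -
  let ?e = "exp (\<alpha> / 2 * (norm \<beta>)\<^sup>2)"
  have "ennreal_pow (heat_transform (\<alpha> * p / 2) (\<lambda>u. norm (f u) powr p) z) (1 / p) = ennreal (norm (f z) * ?e)" for z
    using assms by (subst heat_transform_exp[where a = a and \<beta> = \<beta>]) (auto intro!: ennreal_pow_powr)
  moreover have "ennreal_pow (heat_transform (\<alpha> * q / 2) (\<lambda>u. norm (g u) powr q) z) (1 / q) = ennreal (norm (g z) * ?e)" for z
    using assms by (subst heat_transform_exp[where a = c and \<beta> = "- \<beta>"]) (auto intro!: ennreal_pow_powr)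
  moreover have "ennreal (norm (f z) * ?e) * ennreal (norm (g z) * ?e) = ennreal (norm a * norm c * ?e * ?e)" for z
  proof -
    have "f z * g z = a * c"
      by (simp add: f g hdot_uminus_right exp_minus)
    then have "norm (f z) * norm (g z) = norm a * norm c"
      by (simp flip: norm_mult)
    then show ?thesis
      by (simp flip: ennreal_mult add: mult_ac)
  qed
  ultimately show ?thesis
    by simp
qed

lemma linear_polynomial_hdot: "linear_polynomial (\<lambda>u. b + of_real \<alpha> * hdot u \<beta>)"
  unfolding linear_polynomial_def
  by (intro exI[of _ b] exI[of _ "\<chi> j. of_real \<alpha> * cnj (\<beta> $ j)"])
    (simp add: hdot_def sum_distrib_left mult_ac)

theorem theorem3p7:
  fixes \<alpha> p q :: real
    and f g :: "complex ^ 'n \<Rightarrow> complex"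
  assumes "\<alpha> > 0" and "p > 1" and "1 / p + 1 / q = 1"
    and "f \<in> fock_space \<alpha> p" and "g \<in> fock_space \<alpha> q"
  defines "A \<equiv> toeplitz_prod_bounded \<alpha> p f g"
    and "B \<equiv> (SUP z.
           ennreal_pow (heat_transform (\<alpha> * p / 2) (\<lambda>u. norm (f u) powr p) z) (1 / p) *
           ennreal_pow (heat_transform (\<alpha> * q / 2) (\<lambda>u. norm (g u) powr q) z) (1 / q)) < \<infinity>"
  shows "(A \<longleftrightarrow> B) \<and>
    (A \<or> B \<longrightarrow>
       (\<exists>c. \<forall>z. f z * g z = c) \<and>
       ((\<forall>z. f z \<noteq> 0) \<and> (\<forall>z. g z \<noteq> 0) \<longrightarrow>
          (\<exists>P c. linear_polynomial P \<and>
             (\<forall>z. f z = exp (P z)) \<and>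
             (\<forall>z. g z = c * exp (- P z)) \<and>
             toeplitz_prod_invertible \<alpha> p f (\<lambda>z. inverse (f z)))))"
proof -
  have "q = p / (p - 1)"
    using assms(2,3) by (cases "q = 0") (auto simp: field_simps)
  then have "q > 1"
    using assms(2) by simp
  have "p > 0" "q > 0"
    using assms(2) \<open>q > 1\<close> by auto
  have entire: "entire f" "entire g"
    using assms by (auto dest: fock_spaceD)
  define H where "H = heat_product_bounded \<alpha> p f g"
  have "A \<Longrightarrow> H"
    unfolding A_def H_def using assms toeplitz_prod_bounded_imp_heat_product_bounded by blast
  moreover have "B \<Longrightarrow> H"
    unfolding B_def H_def by (rule SUP_heat_product_imp_bounded) (use assms \<open>q > 1\<close> entire in auto)
  moreover have "A \<and> B \<and> (\<exists>c. \<forall>z. f z * g z = c) \<and>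
       ((\<forall>z. f z \<noteq> 0) \<and> (\<forall>z. g z \<noteq> 0) \<longrightarrow>
          (\<exists>P c. linear_polynomial P \<and> (\<forall>z. f z = exp (P z)) \<and> (\<forall>z. g z = c * exp (- P z)) \<and>
             toeplitz_prod_invertible \<alpha> p f (\<lambda>z. inverse (f z))))" if H
    using assms(1,2) entire that[unfolded H_def]
  proof (cases rule: heat_product_bounded_cases)
    case f_zero
    then have A B
      unfolding A_def B_def using \<open>p > 0\<close> \<open>q > 0\<close>
      by (intro toeplitz_prod_bounded_zero SUP_heat_product_zero; blast)+
    with f_zero show ?thesis by simp
  next
    case g_zero
    then have A B
      unfolding A_def B_def using \<open>p > 0\<close> \<open>q > 0\<close>
      by (intro toeplitz_prod_bounded_zero SUP_heat_product_zero; blast)+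
    with g_zero show ?thesis by simp
  next
    case (exp a c \<beta>)
    have A
      using toeplitz_prod_exp_invertible[OF assms(1-3,5) exp] unfolding A_def toeplitz_prod_invertible_def
      by blast
    moreover have B
      unfolding B_def by (rule SUP_heat_product_exp[OF assms(1) \<open>p > 0\<close> \<open>q > 0\<close> exp(3,4)])
    moreover have "f z * g z = a * c" for z
      by (simp add: exp(3,4) hdot_uminus_right exp_minus)
    moreover have "\<exists>P c. linear_polynomial P \<and> (\<forall>z. f z = exp (P z)) \<and>
        (\<forall>z. g z = c * exp (- P z)) \<and> toeplitz_prod_invertible \<alpha> p f (\<lambda>z. inverse (f z))"
    proof (intro exI conjI allI)
      show "linear_polynomial (\<lambda>u. Ln a + of_real \<alpha> * hdot u \<beta>)"
        by (rule linear_polynomial_hdot)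
      show "f z = exp (Ln a + of_real \<alpha> * hdot z \<beta>)" for z
        using exp(1) by (simp add: exp(3) exp_add)
      show "g z = (a * c) * exp (- (Ln a + of_real \<alpha> * hdot z \<beta>))" for z
        using exp(1) by (simp add: exp(4) hdot_uminus_right exp_minus exp_diff field_simps)
      have inv: "(\<lambda>z. inverse (f z)) = (\<lambda>u. inverse a * exp (of_real \<alpha> * hdot u (- \<beta>)))"
        by (simp add: exp(3) hdot_uminus_right exp_minus)
      have "(\<lambda>z. inverse (f z)) = (\<lambda>u. inverse (a * c) * g u)"
        unfolding inv using exp(1,2) by (simp add: exp(4) fun_eq_iff)
      then have "(\<lambda>z. inverse (f z)) \<in> fock_space \<alpha> q"
        using fock_space_cmult[OF assms(5)] by simp
      then show "toeplitz_prod_invertible \<alpha> p f (\<lambda>z. inverse (f z))"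
        using toeplitz_prod_exp_invertible[OF assms(1-3) _ exp(1) _ exp(3) inv] exp(1) by simp
    qed
    ultimately show ?thesis by blast
  qed
  ultimately show ?thesis by blast
qed

end
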